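(* Let $\epsilon>0$ and $p\in(0,1)$ be fixed, and let $r\ge 3$. Then $$\frac{H_r(n,p,\epsilon)}{E(n,p)}\ge 2^{\Omega(n^{\gamma})},$$ where $\gamma=\frac12-o_n(1)$ if $r\ge 4$ and $\gamma=\frac13-o_n(1)$ if $r=3$ (here $n\to\infty$ over those $n$ for which $p\binom{n}{r}$ is an integer).
   Context: An $r$-graph $G$ has a vertex set $V(G)$ and an edge set consisting of $r$-element subsets of $V(G)$. An $n$-vertex $r$-graph has density $p$ if it has exactly $p\binom{n}{r}$ edges. A Hamiltonian cycle of an $n$-vertex $r$-graph $G$ is given by an ordering $v_1,\dots,v_n$ of its vertices such that for every $i$ the set $\{v_i,\dots,v_{i+r-1}\}$ (indices modulo $n$) is an edge; the cycle is identified with this set of $n$ edges. $H(G)$ is the number of Hamiltonian cycles of $G$. For $\epsilon>0$, an $n$-vertex $r$-graph $G$ is $(\epsilon,p)$-quasi random if its density is $p$ and for every $W\subset V(G)$ with $|W|=\lfloor n/2\rfloor$, the induced $r$-graph $G[W]$ has density (number of edges divided by $\binom{|W|}{r}$) in $(p-\epsilon,p+\epsilon)$. $H_r(n,p,\epsilon)$ is the maximum of $H(G)$ over all $n$-vertex $(\epsilon,p)$-quasi random $r$-graphs $G$. $E(n,p)=p^n(n-1)!/2$. *)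

theory Defs
  imports Complex_Main
begin

definition is_rgraph :: "nat \<Rightarrow> nat \<Rightarrow> nat set set \<Rightarrow> bool" where
  "is_rgraph r n G \<longleftrightarrow> (\<forall>e\<in>G. e \<subseteq> {0..<n} \<and> card e = r)"

definition density :: "nat \<Rightarrow> nat \<Rightarrow> nat set set \<Rightarrow> real" where
  "density r n G = real (card G) / real (n choose r)"

definition induced :: "nat set set \<Rightarrow> nat set \<Rightarrow> nat set set" where
  "induced G W = {e\<in>G. e \<subseteq> W}"

text \<open>Edges of the cycle given by an ordering sigma of the vertices (sigma i = v_(i+1)).\<close>
definition cycle_edges :: "nat \<Rightarrow> nat \<Rightarrow> (nat \<Rightarrow> nat) \<Rightarrow> nat set set" where
  "cycle_edges r n \<sigma> = {(\<lambda>j. \<sigma> ((i + j) mod n)) ` {..<r} | i. i < n}"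

definition ham_cycles :: "nat \<Rightarrow> nat \<Rightarrow> nat set set \<Rightarrow> nat set set set" where
  "ham_cycles r n G = {cycle_edges r n \<sigma> | \<sigma>.
      bij_betw \<sigma> {0..<n} {0..<n} \<and> cycle_edges r n \<sigma> \<subseteq> G}"

definition num_ham :: "nat \<Rightarrow> nat \<Rightarrow> nat set set \<Rightarrow> nat" where
  "num_ham r n G = card (ham_cycles r n G)"

definition quasi_random :: "nat \<Rightarrow> nat \<Rightarrow> real \<Rightarrow> real \<Rightarrow> nat set set \<Rightarrow> bool" where
  "quasi_random r n \<epsilon> p G \<longleftrightarrow> is_rgraph r n G \<and>
     real (card G) = p * real (n choose r) \<and>
     (\<forall>W. W \<subseteq> {0..<n} \<and> card W = n div 2 \<longrightarrow>
        p - \<epsilon> < density r (card W) (induced G W) \<and> density r (card W) (induced G W) < p + \<epsilon>)"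

definition H_max :: "nat \<Rightarrow> nat \<Rightarrow> real \<Rightarrow> real \<Rightarrow> nat" where
  "H_max r n p \<epsilon> = Max {num_ham r n G | G. quasi_random r n \<epsilon> p G}"

definition E_exp :: "nat \<Rightarrow> real \<Rightarrow> real" where
  "E_exp n p = p ^ n * fact (n - 1) / 2"

end

theory Submission
  imports Defs "HOL-Combinatorics.Permutations" "HOL-Real_Asymp.Real_Asymp"
begin

text \<open>The gain is in fact exponential in \<open>n\<close>, so the error term in the exponent can be taken to be 0.
  Give every pair of vertices an independent uniform sign, and let an \<open>r\<close>-set \<open>e\<close> be an edge with
  probability \<open>p (1 + d g e)\<close>, independently, where \<open>g e\<close> is the sum of the signs of the pairs inside
  \<open>e\<close> and \<open>d\<close> is a small constant. All edge probabilities are within a small constant of \<open>p\<close>, so by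
  Chernoff and a union bound the random graph is quasi-random except with probability
  \<open>exp (- \<Omega>(n\<^sup>2))\<close>. Two consecutive windows of a cyclic ordering share a pair (here \<open>r \<ge> 3\<close> is used), so
  their values of \<open>g\<close> are positively correlated, and a fixed cycle survives with probability at least
  \<open>p ^ n (1 + d\<^sup>2) ^ (n div 2)\<close>. The sum of all signs is concentrated too, hence the number of edges
  exceeds its target by a factor of at most \<open>1 + d\<^sup>2 / 16\<close>; deleting the excess costs only a factor \<open>exp (- d\<^sup>2 n / 8)\<close>. Finally, a cycle comes from at most \<open>n ^ r\<close> orderings, because the
  first \<open>r\<close> vertices determine the rest.\<close>

subsection \<open>Random subsets\<close>

text \<open>The probability that a random subset of \<open>A\<close>, containing each
  \<open>x\<close> independently with probability \<open>q x\<close>, equals \<open>S\<close>.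
  Probabilities and expectations are finite weighted sums over \<open>Pow A\<close>
  throughout.\<close>

definition bernoulli_weight :: "('a \<Rightarrow> real) \<Rightarrow> 'a set \<Rightarrow> 'a set \<Rightarrow> real" where
  "bernoulli_weight q A S = (\<Prod>x\<in>S. q x) * (\<Prod>x\<in>A - S. 1 - q x)"

lemma bernoulli_weight_nonneg:
  assumes "S \<subseteq> A" "\<And>x. x \<in> A \<Longrightarrow> 0 \<le> q x \<and> q x \<le> 1"
  shows "0 \<le> bernoulli_weight q A S"
  unfolding bernoulli_weight_def using assms by (intro mult_nonneg_nonneg prod_nonneg) auto

text \<open>Independence in algebraic form: the product over \<open>A\<close> expands over the
  choice, for each element, of its in-term or its out-term. Total mass, superset probability,
  exponential moment and mean of a character are all instances.\<close>

lemma sum_bernoulli_weight_prod: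
  assumes "finite A"
  shows "(\<Sum>S\<in>Pow A. bernoulli_weight q A S * ((\<Prod>x\<in>S. f x) * (\<Prod>x\<in>A - S. h x)))
    = (\<Prod>x\<in>A. q x * f x + (1 - q x) * h x)"
  unfolding prod_add[OF assms] bernoulli_weight_def
  by (intro sum.cong) (auto simp: prod.distrib mult_ac)

lemma sum_bernoulli_weight: "finite A \<Longrightarrow> (\<Sum>S\<in>Pow A. bernoulli_weight q A S) = 1"
  using sum_bernoulli_weight_prod[of A q "\<lambda>_. 1" "\<lambda>_. 1"] by simp

lemma sum_bernoulli_weight_superset:
  assumes "finite A" "C \<subseteq> A"
  shows "(\<Sum>S\<in>Pow A. bernoulli_weight q A S * of_bool (C \<subseteq> S)) = (\<Prod>x\<in>C. q x)"
proof -
  \<comment> \<open>The indicator is rewritten as a product over the omitted elements, which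
    vanishes as soon as one of them lies in \<open>C\<close>; this is the shape the product formula
    handles.\<close>
  have "(\<Prod>x\<in>A - S. if x \<in> C then 0 else 1) = (of_bool (C \<subseteq> S) :: real)" if "S \<in> Pow A" for S
    using assms that by (cases "C \<subseteq> S") (auto simp: finite_subset intro!: prod.neutral)
  then have "(\<Sum>S\<in>Pow A. bernoulli_weight q A S * of_bool (C \<subseteq> S))
      = (\<Sum>S\<in>Pow A. bernoulli_weight q A S * ((\<Prod>x\<in>S. 1) * (\<Prod>x\<in>A - S. if x \<in> C then 0 else 1)))"
    by (intro sum.cong) auto
  also have "\<dots> = (\<Prod>x\<in>A. if x \<in> C then q x else 1)"
    unfolding sum_bernoulli_weight_prod[OF assms(1)] by (intro prod.cong) auto
  also have "\<dots> = (\<Prod>x\<in>C. q x)"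
    using assms by (simp add: prod.If_cases Int_absorb1)
  finally show ?thesis .
qed

section \<open>Exponential moments and Chernoff bounds\<close>

lemma exp_le_quadratic:
  fixes x :: real
  assumes "\<bar>x\<bar> \<le> 1"
  shows "exp x \<le> 1 + x + x\<^sup>2"
proof (cases "0 \<le> x")
  case True
  then show ?thesis using exp_bound[of x] assms by simp
next
  case False
  define y where "y = - x"
  have y: "0 < y" using False by (simp add: y_def)
  \<comment> \<open>The right-hand side equals \<open>1 + y^3\<close>.\<close>
  have "1 \<le> (1 - y + y\<^sup>2) * (1 + y)"
    using y by (simp add: algebra_simps power2_eq_square)
  also have "\<dots> \<le> (1 - y + y\<^sup>2) * exp y"
  proof (rule mult_left_mono)
    have "1 - y + y\<^sup>2 = (1 - y/2)\<^sup>2 + 3/4 * y\<^sup>2"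
      by (simp add: power2_eq_square field_simps)
    then show "0 \<le> 1 - y + y\<^sup>2" by simp
  qed (simp add: exp_ge_add_one_self)
  finally have "exp (- y) \<le> 1 - y + y\<^sup>2"
    by (simp add: exp_minus field_simps)
  then show ?thesis by (simp add: y_def)
qed

text \<open>The moment generating function of a sum of independent indicators factorises over
  \<open>T\<close>, and each factor is bounded through \<open>1 + u \<le> exp u\<close>.\<close>

lemma sum_bernoulli_weight_exp_card:
  assumes "finite A" "T \<subseteq> A" "\<And>x. x \<in> A \<Longrightarrow> 0 \<le> q x \<and> q x \<le> 1"
  shows "(\<Sum>S\<in>Pow A. bernoulli_weight q A S * exp (l * real (card (S \<inter> T)))) \<le> exp ((exp l - 1) * sum q T)"
proof -
  have "exp (l * real (card (S \<inter> T))) = (\<Prod>x\<in>S. if x \<in> T then exp l else 1)" if "S \<in> Pow A" for S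
    using assms that by (simp add: prod.If_cases finite_subset exp_of_nat2_mult Int_def)
  then have "(\<Sum>S\<in>Pow A. bernoulli_weight q A S * exp (l * real (card (S \<inter> T))))
      = (\<Sum>S\<in>Pow A. bernoulli_weight q A S * ((\<Prod>x\<in>S. if x \<in> T then exp l else 1) * (\<Prod>x\<in>A - S. 1)))"
    by (intro sum.cong) auto
  also have "\<dots> = (\<Prod>x\<in>A. if x \<in> T then 1 + (exp l - 1) * q x else 1)"
    unfolding sum_bernoulli_weight_prod[OF assms(1)] by (intro prod.cong) (simp_all add: left_diff_distrib right_diff_distrib mult.commute)
  also have "\<dots> = (\<Prod>x\<in>T. 1 + (exp l - 1) * q x)"
    using assms by (simp add: prod.If_cases Int_absorb1)
  also have "\<dots> \<le> (\<Prod>x\<in>T. exp ((exp l - 1) * q x))"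
  proof (intro prod_mono conjI)
    fix x assume "x \<in> T"
    then have q: "0 \<le> q x" "q x \<le> 1" using assms by auto
    have "0 \<le> (1 - q x) + exp l * q x" using q by simp
    then show "0 \<le> 1 + (exp l - 1) * q x" by (simp add: algebra_simps)
  qed (rule exp_ge_add_one_self)
  also have "\<dots> = exp ((exp l - 1) * sum q T)"
    using finite_subset[OF assms(2,1)] by (simp add: exp_sum sum_distrib_left)
  finally show ?thesis .
qed

text \<open>Markov's inequality for the exponential moment; the sign \<open>s\<close> covers both
  tails with one argument.\<close>

lemma chernoff_one_sided:
  assumes "finite A" "T \<subseteq> A" "\<And>x. x \<in> A \<Longrightarrow> 0 \<le> q x \<and> q x \<le> 1"
    and "0 \<le> t" "t \<le> 1" and s: "\<bar>s\<bar> = 1"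
  shows "(\<Sum>S | S \<subseteq> A \<and> s * (real (card (S \<inter> T)) - sum q T) \<ge> t * real (card T). bernoulli_weight q A S)
    \<le> exp (- (t\<^sup>2 * real (card T) / 4))"
proof -
  \<comment> \<open>The exponent per element of \<open>T\<close> comes out as at most
    \<open>l^2 - t * abs l\<close>, which is smallest at \<open>abs l = t / 2\<close>, with value
    \<open>- t^2 / 4\<close>. The factor \<open>c\<close> makes
    \<open>c * exp (l * card (S \<inter> T))\<close> at least 1 on the tail.\<close>
  define l where "l = s * (t / 2)"
  define c where "c = exp (- (l * sum q T) - t\<^sup>2 / 2 * real (card T))"
  have ls: "l * z = t / 2 * (s * z)" for z by (simp add: l_def)
  have l: "\<bar>l\<bar> \<le> 1" using assms(4,5) s by (simp add: l_def abs_mult)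
  have l2: "l\<^sup>2 = t\<^sup>2 / 4"
    using s by (auto simp: l_def power_mult_distrib power_divide abs_if split: if_splits)
  have T: "sum q T \<le> card T" "0 \<le> sum q T"
    using sum_mono[of T q "\<lambda>_. 1"] assms by (auto intro!: sum_nonneg)
  have "(\<Sum>S | S \<subseteq> A \<and> s * (real (card (S \<inter> T)) - sum q T) \<ge> t * real (card T). bernoulli_weight q A S)
      \<le> (\<Sum>S | S \<subseteq> A \<and> s * (real (card (S \<inter> T)) - sum q T) \<ge> t * real (card T).
          bernoulli_weight q A S * (c * exp (l * real (card (S \<inter> T)))))"
  proof (rule sum_mono)
    fix S assume S: "S \<in> {S. S \<subseteq> A \<and> s * (real (card (S \<inter> T)) - sum q T) \<ge> t * real (card T)}"
    have "t / 2 * (t * card T) \<le> t / 2 * (s * (real (card (S \<inter> T)) - sum q T))"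
      using S assms by (intro mult_left_mono) auto
    then have "0 \<le> - (l * sum q T) - t\<^sup>2 / 2 * real (card T) + l * real (card (S \<inter> T))"
      by (simp add: ls power2_eq_square algebra_simps)
    then have "1 \<le> c * exp (l * real (card (S \<inter> T)))"
      unfolding c_def exp_add[symmetric] by (subst one_le_exp_iff)
    then show "bernoulli_weight q A S \<le> bernoulli_weight q A S * (c * exp (l * real (card (S \<inter> T))))"
      using bernoulli_weight_nonneg[of S A q] assms S mult_left_mono[of 1 _ "bernoulli_weight q A S"] by simp
  qed
  also have "\<dots> \<le> (\<Sum>S\<in>Pow A. bernoulli_weight q A S * (c * exp (l * real (card (S \<inter> T)))))"
    using assms by (intro sum_mono2) (auto intro!: mult_nonneg_nonneg bernoulli_weight_nonneg simp: c_def)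
  also have "\<dots> = c * (\<Sum>S\<in>Pow A. bernoulli_weight q A S * exp (l * real (card (S \<inter> T))))"
    by (simp add: sum_distrib_left mult_ac)
  also have "\<dots> \<le> c * exp ((exp l - 1) * sum q T)"
    using sum_bernoulli_weight_exp_card[OF assms(1-3)] by (intro mult_left_mono) (auto simp: c_def)
  also have "\<dots> = exp ((exp l - 1 - l) * sum q T - t\<^sup>2 / 2 * real (card T))"
    by (simp add: c_def exp_add[symmetric] algebra_simps)
  also have "\<dots> \<le> exp (- (t\<^sup>2 * real (card T) / 4))"
  proof -
    have "(exp l - 1 - l) * sum q T \<le> l\<^sup>2 * real (card T)"
      using exp_le_quadratic[OF l] T by (intro mult_mono) auto
    then show ?thesis by (simp add: l2)
  qed
  finally show ?thesis .
qed

lemma sum_Un_le: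
  fixes w :: "'a \<Rightarrow> real"
  assumes "finite X" "finite Y" "\<And>x. x \<in> X \<Longrightarrow> 0 \<le> w x"
  shows "sum w (X \<union> Y) \<le> sum w X + sum w Y"
proof -
  have "0 \<le> sum w (X \<inter> Y)" using assms by (intro sum_nonneg) auto
  then show ?thesis using sum.union_inter[OF assms(1,2), of w] by linarith
qed

lemma chernoff:
  assumes "finite A" "T \<subseteq> A" "\<And>x. x \<in> A \<Longrightarrow> 0 \<le> q x \<and> q x \<le> 1" and "0 \<le> t" "t \<le> 1"
  shows "(\<Sum>S | S \<subseteq> A \<and> \<bar>real (card (S \<inter> T)) - sum q T\<bar> \<ge> t * real (card T). bernoulli_weight q A S)
    \<le> 2 * exp (- (t\<^sup>2 * real (card T) / 4))"
proof -
  let ?B = "\<lambda>s. {S. S \<subseteq> A \<and> s * (real (card (S \<inter> T)) - sum q T) \<ge> t * real (card T)}"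
  have fin: "finite (?B s)" for s
    using assms(1) by (rule_tac finite_subset[of _ "Pow A"]) auto
  have "{S. S \<subseteq> A \<and> \<bar>real (card (S \<inter> T)) - sum q T\<bar> \<ge> t * real (card T)} = ?B 1 \<union> ?B (-1)"
    by auto
  moreover have "sum (bernoulli_weight q A) (?B 1 \<union> ?B (-1)) \<le> sum (bernoulli_weight q A) (?B 1) + sum (bernoulli_weight q A) (?B (-1))"
    using assms(3) by (intro sum_Un_le fin bernoulli_weight_nonneg) auto
  moreover have "sum (bernoulli_weight q A) (?B 1) \<le> exp (- (t\<^sup>2 * real (card T) / 4))"
    by (rule chernoff_one_sided[OF assms]) auto
  moreover have "sum (bernoulli_weight q A) (?B (-1)) \<le> exp (- (t\<^sup>2 * real (card T) / 4))"
    by (rule chernoff_one_sided[OF assms]) auto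
  ultimately show ?thesis by simp
qed

text \<open>The outcomes with \<open>P\<close> contribute at most \<open>M * b\<close> to the mean,
  and the others have total mass at most 1, so one of them must carry a value of at least
  \<open>a - M * b\<close>.\<close>

lemma weighted_average_avoiding:
  fixes w f :: "'a \<Rightarrow> real"
  assumes "finite \<Omega>" "\<And>x. x \<in> \<Omega> \<Longrightarrow> 0 \<le> w x" "sum w \<Omega> \<le> 1" "\<And>x. x \<in> \<Omega> \<Longrightarrow> f x \<le> M" "0 \<le> M"
    and "a \<le> (\<Sum>x\<in>\<Omega>. w x * f x)" "(\<Sum>x | x \<in> \<Omega> \<and> P x. w x) \<le> b" "M * b < a"
  shows "\<exists>x\<in>\<Omega>. \<not> P x \<and> a - M * b \<le> f x"
proof (rule ccontr)
  assume "\<not> ?thesis"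
  then have less: "f x < a - M * b" if "x \<in> \<Omega>" "\<not> P x" for x
    using that by force
  have split: "(\<Sum>x\<in>\<Omega>. g x) = (\<Sum>x | x \<in> \<Omega> \<and> P x. g x) + (\<Sum>x | x \<in> \<Omega> \<and> \<not> P x. g x)" for g :: "'a \<Rightarrow> real"
    using sum.Int_Diff[OF assms(1), of g "Collect P"]
    by (simp add: Int_def set_diff_eq)
  have "(\<Sum>x | x \<in> \<Omega> \<and> P x. w x * f x) \<le> (\<Sum>x | x \<in> \<Omega> \<and> P x. w x * M)"
    using assms by (intro sum_mono mult_left_mono) auto
  also have "\<dots> \<le> M * b"
    using mult_left_mono[OF assms(7,5)] by (simp add: sum_distrib_left mult.commute)
  finally have good: "a - M * b \<le> (\<Sum>x | x \<in> \<Omega> \<and> \<not> P x. w x * f x)"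
    using assms(6) split[of "\<lambda>x. w x * f x"] by linarith
  \<comment> \<open>A point of positive weight is what makes the comparison of the two sums strict;
    it exists because \<open>a - M * b\<close> is positive.\<close>
  have "\<exists>x. x \<in> \<Omega> \<and> \<not> P x \<and> 0 < w x"
  proof (rule ccontr)
    assume "\<not> ?thesis"
    then have "(\<Sum>x | x \<in> \<Omega> \<and> \<not> P x. w x * f x) = 0"
      using assms(2) by (intro sum.neutral) force
    then show False using good assms(8) by simp
  qed
  then obtain y where y: "y \<in> \<Omega>" "\<not> P y" "0 < w y" by blast
  have "(\<Sum>x | x \<in> \<Omega> \<and> \<not> P x. w x * f x) < (\<Sum>x | x \<in> \<Omega> \<and> \<not> P x. w x * (a - M * b))"
    using assms(1,2) y less
    by (intro sum_strict_mono_ex1 bexI[of _ y] ballI mult_left_mono mult_strict_left_mono)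
      (auto intro: less_imp_le)
  also have "\<dots> = (\<Sum>x | x \<in> \<Omega> \<and> \<not> P x. w x) * (a - M * b)"
    by (simp add: sum_distrib_right)
  also have "\<dots> \<le> 1 * (a - M * b)"
  proof (rule mult_right_mono)
    have "0 \<le> (\<Sum>x | x \<in> \<Omega> \<and> P x. w x)" using assms(2) by (intro sum_nonneg) auto
    then show "(\<Sum>x | x \<in> \<Omega> \<and> \<not> P x. w x) \<le> 1" using split[of w] assms(3) by linarith
  qed (use assms(8) in simp)
  finally show False using good by simp
qed

subsection \<open>Nonnegative combinations of characters\<close>

text \<open>A configuration of signs is encoded by the set \<open>Y\<close> of elements with sign
  \<open>+1\<close>; independent uniform signs then correspond to a random subset with inclusion
  probability 1/2.\<close>

definition mem_sign :: "'a set \<Rightarrow> 'a \<Rightarrow> real" where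
  "mem_sign Y T = (if T \<in> Y then 1 else - 1)"

text \<open>The cone spanned by the Walsh characters of the sign cube. It is closed under products
  and its members have nonnegative mean, so membership replaces any computation with Fourier
  coefficients.\<close>

inductive nonneg_char :: "'a set \<Rightarrow> ('a set \<Rightarrow> real) \<Rightarrow> bool" for K where
  zero: "nonneg_char K (\<lambda>_. 0)"
| char: "U \<subseteq> K \<Longrightarrow> nonneg_char K (\<lambda>Y. \<Prod>T\<in>U. mem_sign Y T)"
| add: "nonneg_char K f \<Longrightarrow> nonneg_char K g \<Longrightarrow> nonneg_char K (\<lambda>Y. f Y + g Y)"
| scale: "0 \<le> c \<Longrightarrow> nonneg_char K f \<Longrightarrow> nonneg_char K (\<lambda>Y. c * f Y)"

lemma nonneg_char_const: "0 \<le> c \<Longrightarrow> nonneg_char K (\<lambda>_. c)"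
  using nonneg_char.scale[OF _ nonneg_char.char[of "{}" K], of c] by simp

lemma nonneg_char_mem_sign: "T \<in> K \<Longrightarrow> nonneg_char K (\<lambda>Y. mem_sign Y T)"
  using nonneg_char.char[of "{T}" K] by simp

lemma nonneg_char_sum: "(\<And>i. i \<in> I \<Longrightarrow> nonneg_char K (f i)) \<Longrightarrow> nonneg_char K (\<lambda>Y. \<Sum>i\<in>I. f i Y)"
  by (induction I rule: infinite_finite_induct) (auto intro: nonneg_char.intros)

text \<open>Signs of common elements are squared to 1, so only the symmetric difference survives:
  characters are closed under multiplication.\<close>

lemma prod_mem_sign_mult:
  assumes "finite U" "finite V"
  shows "(\<Prod>T\<in>U. mem_sign Y T) * (\<Prod>T\<in>V. mem_sign Y T) = (\<Prod>T\<in>(U - V) \<union> (V - U). mem_sign Y T)"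
proof -
  have "(\<Prod>T\<in>U \<inter> V. mem_sign Y T) * (\<Prod>T\<in>U \<inter> V. mem_sign Y T) = 1"
    unfolding prod.distrib[symmetric] by (intro prod.neutral) (auto simp: mem_sign_def)
  moreover have "(\<Prod>T\<in>U. mem_sign Y T) = (\<Prod>T\<in>U \<inter> V. mem_sign Y T) * (\<Prod>T\<in>U - V. mem_sign Y T)"
    using assms by (rule_tac prod.Int_Diff)
  moreover have "(\<Prod>T\<in>V. mem_sign Y T) = (\<Prod>T\<in>U \<inter> V. mem_sign Y T) * (\<Prod>T\<in>V - U. mem_sign Y T)"
    using assms by (subst Int_commute, rule_tac prod.Int_Diff)
  moreover have "(\<Prod>T\<in>(U - V) \<union> (V - U). mem_sign Y T) = (\<Prod>T\<in>U - V. mem_sign Y T) * (\<Prod>T\<in>V - U. mem_sign Y T)"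
    using assms by (intro prod.union_disjoint) auto
  moreover have "c * a * (c * b) = (c * c) * (a * b)" for a b c :: real
    by (simp only: mult_ac)
  ultimately show ?thesis by simp
qed

text \<open>By bilinearity it is enough to multiply two characters, which gives a character; hence
  an induction on \<open>g\<close> nested in the character case of the induction on
  \<open>f\<close>.\<close>

lemma nonneg_char_mult:
  assumes "finite K" "nonneg_char K f" "nonneg_char K g"
  shows "nonneg_char K (\<lambda>Y. f Y * g Y)"
  using assms(2)
proof induction
  case zero
  show ?case by (simp add: nonneg_char.zero)
next
  case (char U)
  show ?case using assms(3)
  proof induction
    case zero
    show ?case by (simp add: nonneg_char.zero)
  next
    case (char V)
    have "nonneg_char K (\<lambda>Y. \<Prod>T\<in>(U - V) \<union> (V - U). mem_sign Y T)"
      using char \<open>U \<subseteq> K\<close> by (intro nonneg_char.char) auto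
    then show ?case
      using prod_mem_sign_mult[of U V] char \<open>U \<subseteq> K\<close> assms(1) by (simp add: finite_subset)
  qed (simp_all add: distrib_left nonneg_char.add nonneg_char.scale mult.left_commute)
qed (simp_all add: distrib_right nonneg_char.add nonneg_char.scale mult.assoc)

text \<open>A character has mean 1 if \<open>U\<close> is empty and 0 otherwise; the product formula
  shows nonnegativity without distinguishing the cases, each factor being 0 or 1.\<close>

lemma nonneg_char_mean_nonneg:
  assumes "finite K" "nonneg_char K f"
  shows "0 \<le> (\<Sum>Y\<in>Pow K. bernoulli_weight (\<lambda>_. 1/2) K Y * f Y)"
  using assms(2)
proof induction
  case (char U)
  have "(\<Prod>T\<in>U. mem_sign Y T) = (\<Prod>T\<in>K - Y. if T \<in> U then -1 else 1)" if "Y \<in> Pow K" for Y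
  proof -
    have "(\<Prod>T\<in>U. mem_sign Y T) = (\<Prod>T\<in>K. if T \<in> U then mem_sign Y T else 1)"
      using char assms(1) by (simp add: prod.If_cases Int_absorb1)
    also have "\<dots> = (\<Prod>T\<in>K - Y. if T \<in> U then -1 else 1)"
      using that assms(1) by (intro prod.mono_neutral_cong_right) (auto simp: mem_sign_def)
    finally show ?thesis .
  qed
  then have "(\<Sum>Y\<in>Pow K. bernoulli_weight (\<lambda>_. 1/2) K Y * (\<Prod>T\<in>U. mem_sign Y T))
    = (\<Sum>Y\<in>Pow K. bernoulli_weight (\<lambda>_. 1/2) K Y * ((\<Prod>T\<in>Y. 1) * (\<Prod>T\<in>K - Y. if T \<in> U then -1 else 1)))"
    by (intro sum.cong) auto
  also have "\<dots> \<ge> 0"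
    unfolding sum_bernoulli_weight_prod[OF assms(1)] by (intro prod_nonneg) auto
  finally show ?case .
next
  case (scale c f)
  then have "0 \<le> c * (\<Sum>Y\<in>Pow K. bernoulli_weight (\<lambda>_. 1/2) K Y * f Y)" by simp
  then show ?case by (simp add: sum_distrib_left mult_ac)
qed (simp_all add: distrib_left sum.distrib)

text \<open>Pairing up factors, \<open>(1 + d g\<^sub>i) (1 + d g\<^sub>i\<^sub>+\<^sub>1)\<close> is \<open>1 + d\<^sup>2\<close> plus a nonnegative combination of
  characters, so no negative term appears when the pairs are multiplied out.\<close>

lemma nonneg_char_prod_consecutive:
  assumes "finite K" "0 \<le> d" "\<And>i. i < n \<Longrightarrow> nonneg_char K (g i)"
    and "\<And>i. Suc i < n \<Longrightarrow> nonneg_char K (\<lambda>Y. g i Y * g (Suc i) Y - 1)"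
  shows "nonneg_char K (\<lambda>Y. (\<Prod>i<n. 1 + d * g i Y) - (1 + d\<^sup>2) ^ (n div 2))"
  using assms(3,4)
proof (induction n rule: induct_nat_012)
  case 0
  then show ?case by (simp add: nonneg_char.zero)
next
  case 1
  then show ?case using assms(2) by (simp add: nonneg_char.scale)
next
  \<comment> \<open>The induction removes the last two factors at a time. For odd \<open>n\<close>
    the factor of index 0 stays alone and contributes only \<open>d * g 0 Y\<close> beyond the
    constant 1.\<close>
  case (ge2 n)
  let ?P = "\<lambda>Y. \<Prod>i<n. 1 + d * g i Y" and ?c = "(1 + d\<^sup>2) ^ (n div 2)"
  let ?F = "\<lambda>Y. (1 + d * g n Y) * (1 + d * g (Suc n) Y)"
  have IH: "nonneg_char K (\<lambda>Y. ?P Y - ?c)" using ge2 by auto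
  have F: "nonneg_char K ?F"
    using ge2 assms by (intro nonneg_char_mult nonneg_char.add nonneg_char.scale nonneg_char_const) auto
  \<comment> \<open>This is \<open>?F Y - (1 + d^2)\<close>. Hence
    \<open>(?P - ?c) * ?F + ?c * ?H\<close> equals the longer product minus
    \<open>?c * (1 + d^2)\<close>.\<close>
  let ?H = "\<lambda>Y. (d * g n Y + d * g (Suc n) Y) + d\<^sup>2 * (g n Y * g (Suc n) Y - 1)"
  have H: "nonneg_char K ?H"
    using ge2 assms by (intro nonneg_char.add nonneg_char.scale) auto
  have "nonneg_char K (\<lambda>Y. (?P Y - ?c) * ?F Y + ?c * ?H Y)"
    by (rule nonneg_char.add[OF nonneg_char_mult[OF assms(1) IH F] nonneg_char.scale[OF _ H]]) simp
  also have "(\<lambda>Y. (?P Y - ?c) * ?F Y + ?c * ?H Y)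
      = (\<lambda>Y. (\<Prod>i<Suc (Suc n). 1 + d * g i Y) - (1 + d\<^sup>2) ^ (Suc (Suc n) div 2))"
    by (rule ext) (simp add: algebra_simps power2_eq_square)
  finally show ?case .
qed

subsection \<open>Signed pairs of vertices\<close>

definition subsets_of_card :: "nat \<Rightarrow> 'a set \<Rightarrow> 'a set set" where
  "subsets_of_card k V = {e. e \<subseteq> V \<and> card e = k}"

lemma finite_subsets_of_card: "finite V \<Longrightarrow> finite (subsets_of_card k V)"
  by (rule finite_subset[of _ "Pow V"]) (auto simp: subsets_of_card_def)

lemma card_subsets_of_card: "finite V \<Longrightarrow> card (subsets_of_card k V) = card V choose k"
  unfolding subsets_of_card_def by (rule n_subsets)

text \<open>Removing \<open>T\<close> is a bijection onto the subsets of \<open>V - T\<close> of the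
  complementary size.\<close>

lemma card_supersets_of_card:
  assumes "finite V" "T \<subseteq> V" "card T \<le> r"
  shows "card {e \<in> subsets_of_card r V. T \<subseteq> e} = (card V - card T) choose (r - card T)"
proof -
  have fT: "finite T" using assms finite_subset by blast
  have "bij_betw (\<lambda>e. e - T) {e \<in> subsets_of_card r V. T \<subseteq> e} (subsets_of_card (r - card T) (V - T))"
  proof (rule bij_betwI[where g = "\<lambda>X. X \<union> T"])
    show "(\<lambda>e. e - T) \<in> {e \<in> subsets_of_card r V. T \<subseteq> e} \<rightarrow> subsets_of_card (r - card T) (V - T)"
      using fT by (auto simp: subsets_of_card_def card_Diff_subset)
    show "(\<lambda>X. X \<union> T) \<in> subsets_of_card (r - card T) (V - T) \<rightarrow> {e \<in> subsets_of_card r V. T \<subseteq> e}"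
    proof
      fix X assume X: "X \<in> subsets_of_card (r - card T) (V - T)"
      then have "finite X" using assms(1) by (auto simp: subsets_of_card_def dest: finite_subset)
      then have "card (X \<union> T) = card X + card T"
        using X fT by (intro card_Un_disjoint) (auto simp: subsets_of_card_def)
      then show "X \<union> T \<in> {e \<in> subsets_of_card r V. T \<subseteq> e}"
        using X assms by (auto simp: subsets_of_card_def)
    qed
  qed (auto simp: subsets_of_card_def)
  then show ?thesis
    using assms fT by (simp add: bij_betw_same_card card_subsets_of_card card_Diff_subset)
qed

definition pair_sign_sum :: "'a set set \<Rightarrow> 'a set \<Rightarrow> real" where
  "pair_sign_sum Y e = (\<Sum>T\<in>subsets_of_card 2 e. mem_sign Y T)"

lemma abs_pair_sign_sum_le:
  assumes "finite e"
  shows "\<bar>pair_sign_sum Y e\<bar> \<le> real (card e choose 2)"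
proof -
  have "\<bar>pair_sign_sum Y e\<bar> \<le> (\<Sum>T\<in>subsets_of_card 2 e. \<bar>mem_sign Y T\<bar>)"
    unfolding pair_sign_sum_def by (rule sum_abs)
  also have "\<dots> = card (subsets_of_card 2 e)"
    by (simp add: mem_sign_def if_distrib[of abs] cong: if_cong)
  finally show ?thesis using assms by (simp add: card_subsets_of_card)
qed

text \<open>Double counting of pairs inside \<open>r\<close>-sets. It reduces the total of all edge
  probabilities to the number of positive pairs, a single quantity that concentrates well.\<close>

lemma sum_pair_sign_sum:
  assumes "finite V" "2 \<le> r"
  shows "(\<Sum>e\<in>subsets_of_card r V. pair_sign_sum Y e)
    = real ((card V - 2) choose (r - 2)) * (\<Sum>T\<in>subsets_of_card 2 V. mem_sign Y T)"
proof -
  let ?E = "subsets_of_card r V" and ?K = "subsets_of_card 2 V"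
  have "(\<Sum>e\<in>?E. pair_sign_sum Y e) = (\<Sum>e\<in>?E. \<Sum>T | T \<in> ?K \<and> T \<subseteq> e. mem_sign Y T)"
    unfolding pair_sign_sum_def by (intro sum.cong) (auto simp: subsets_of_card_def)
  also have "\<dots> = (\<Sum>T\<in>?K. \<Sum>e | e \<in> ?E \<and> T \<subseteq> e. mem_sign Y T)"
    using assms by (intro sum.swap_restrict finite_subsets_of_card)
  also have "\<dots> = (\<Sum>T\<in>?K. real ((card V - 2) choose (r - 2)) * mem_sign Y T)"
  proof (rule sum.cong)
    fix T assume "T \<in> ?K"
    then have "T \<subseteq> V" "card T = 2" by (auto simp: subsets_of_card_def)
    then show "(\<Sum>e | e \<in> ?E \<and> T \<subseteq> e. mem_sign Y T) = real ((card V - 2) choose (r - 2)) * mem_sign Y T"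
      using card_supersets_of_card[of V T r] assms by simp
  qed simp
  finally show ?thesis by (simp add: sum_distrib_left)
qed

lemma sum_mem_sign:
  assumes "finite K" "Y \<subseteq> K"
  shows "(\<Sum>T\<in>K. mem_sign Y T) = 2 * real (card Y) - real (card K)"
proof -
  have "(\<Sum>T\<in>K. mem_sign Y T) = (\<Sum>T\<in>K. 2 * (if T \<in> Y then 1 else 0) - 1)"
    by (intro sum.cong) (auto simp: mem_sign_def)
  also have "\<dots> = 2 * real (card (K \<inter> Y)) - real (card K)"
    using assms by (simp add: sum_subtractf sum_distrib_left[symmetric] sum.If_cases)
  finally show ?thesis using assms by (simp add: Int_absorb1)
qed

subsection \<open>Windows of a cyclic ordering\<close>

definition cyc_window :: "nat \<Rightarrow> nat \<Rightarrow> (nat \<Rightarrow> nat) \<Rightarrow> nat \<Rightarrow> nat set" where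
  "cyc_window r n \<sigma> i = (\<lambda>j. \<sigma> ((i + j) mod n)) ` {..<r}"

lemma cycle_edges_eq: "cycle_edges r n \<sigma> = cyc_window r n \<sigma> ` {..<n}"
  by (auto simp: cycle_edges_def cyc_window_def)

lemma mod_add_left_inj:
  fixes n :: nat
  assumes "(i + j) mod n = (i + k) mod n" "j < n" "k < n"
  shows "j = k"
  using assms
proof (induction j k rule: linorder_wlog)
  case (le j k)
  then have "n dvd (i + k) - (i + j)" by (metis add_left_mono mod_eq_dvd_iff_nat)
  then show ?case using le by (auto dest: dvd_imp_le)
qed simp

lemma cyc_window_in_subsets_of_card:
  assumes "\<sigma> permutes {0..<n}" "r \<le> n" "0 < n"
  shows "cyc_window r n \<sigma> i \<in> subsets_of_card r {0..<n}"
proof -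
  have "inj_on (\<lambda>j. \<sigma> ((i + j) mod n)) {..<r}"
  proof (rule inj_onI)
    fix j k assume "j \<in> {..<r}" "k \<in> {..<r}" "\<sigma> ((i + j) mod n) = \<sigma> ((i + k) mod n)"
    then show "j = k"
      using permutes_inj[OF assms(1)] assms(2) mod_add_left_inj[of i j n k] by (auto dest: injD)
  qed
  then have "card (cyc_window r n \<sigma> i) = r" by (simp add: cyc_window_def card_image)
  moreover have "\<sigma> ((i + j) mod n) \<in> {0..<n}" for j
    unfolding permutes_in_image[OF assms(1)] using assms(3) by simp
  ultimately show ?thesis by (auto simp: cyc_window_def subsets_of_card_def)
qed

lemma nonneg_char_pair_sign_sum:
  assumes "e \<subseteq> V"
  shows "nonneg_char (subsets_of_card 2 V) (\<lambda>Y. pair_sign_sum Y e)"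
  unfolding pair_sign_sum_def using assms by (intro nonneg_char_sum nonneg_char_mem_sign) (auto simp: subsets_of_card_def)

text \<open>The shared pair \<open>T\<close> occurs in both sums and contributes
  \<open>mem_sign Y T\<close> squared, that is 1, to the product. All other terms, including those
  of further shared pairs, stay in the cone.\<close>

lemma nonneg_char_pair_sign_sum_overlap:
  assumes "finite V" "e \<subseteq> V" "e' \<subseteq> V" "T \<subseteq> e" "T \<subseteq> e'" "card T = 2"
  shows "nonneg_char (subsets_of_card 2 V) (\<lambda>Y. pair_sign_sum Y e * pair_sign_sum Y e' - 1)"
proof -
  let ?K = "subsets_of_card 2 V"
  define R where "R e Y = (\<Sum>T\<in>subsets_of_card 2 e - {T}. mem_sign Y T)" for e Y
  have fin: "finite ?K" by (rule finite_subsets_of_card[OF assms(1)])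
  have split: "pair_sign_sum Y f = mem_sign Y T + R f Y" if "f \<subseteq> V" "T \<subseteq> f" for f Y
    using that assms(1,6) unfolding pair_sign_sum_def R_def
    by (intro sum.remove finite_subsets_of_card) (auto simp: subsets_of_card_def dest: finite_subset)
  have R: "nonneg_char ?K (R f)" if "f \<subseteq> V" for f
    unfolding R_def using that by (intro nonneg_char_sum nonneg_char_mem_sign) (auto simp: subsets_of_card_def)
  have T: "nonneg_char ?K (\<lambda>Y. mem_sign Y T)"
    using assms by (intro nonneg_char_mem_sign) (auto simp: subsets_of_card_def)
  have "nonneg_char ?K (\<lambda>Y. (mem_sign Y T * R e' Y + R e Y * mem_sign Y T) + R e Y * R e' Y)"
    using fin R T assms by (intro nonneg_char.add nonneg_char_mult) auto
  also have "(\<lambda>Y. (mem_sign Y T * R e' Y + R e Y * mem_sign Y T) + R e Y * R e' Y)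
      = (\<lambda>Y. pair_sign_sum Y e * pair_sign_sum Y e' - 1)"
  proof
    fix Y
    have "mem_sign Y T * mem_sign Y T = 1" by (simp add: mem_sign_def)
    then show "(mem_sign Y T * R e' Y + R e Y * mem_sign Y T) + R e Y * R e' Y = pair_sign_sum Y e * pair_sign_sum Y e' - 1"
      using assms by (simp add: split algebra_simps)
  qed
  finally show ?thesis .
qed

lemma cyc_window_overlap:
  assumes "\<sigma> permutes {0..<n}" "3 \<le> r" "2 \<le> n"
  shows "\<exists>T. T \<subseteq> cyc_window r n \<sigma> i \<and> T \<subseteq> cyc_window r n \<sigma> (Suc i) \<and> card T = 2"
proof (intro exI conjI)
  \<comment> \<open>Second and third vertex of window \<open>i\<close>, first and second of the next
    one; this needs windows of length at least 3.\<close>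
  let ?T = "{\<sigma> ((i + 1) mod n), \<sigma> ((i + 2) mod n)}"
  have mem: "\<sigma> ((l + j) mod n) \<in> cyc_window r n \<sigma> l" if "j < r" for l j
    using that by (auto simp: cyc_window_def)
  show "?T \<subseteq> cyc_window r n \<sigma> i"
    using mem[of 1 i] mem[of 2 i] assms(2) by simp
  show "?T \<subseteq> cyc_window r n \<sigma> (Suc i)"
    using mem[of 0 "Suc i"] mem[of 1 "Suc i"] assms(2) by simp
  have "(i + 1) mod n \<noteq> (i + 2) mod n"
    using assms(3) mod_Suc[of "i + 1" n] by (auto split: if_splits)
  then show "card ?T = 2"
    using permutes_inj[OF assms(1)] by (auto simp: card_2_iff dest: injD)
qed

text \<open>Windows at different indices could coincide, so a cycle may have fewer than
  \<open>n\<close> edges. A repeated factor is at most 1, and the product over indices is still a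
  lower bound.\<close>

lemma prod_image_ge:
  fixes q :: "'b \<Rightarrow> real"
  assumes "finite I" "\<And>i. i \<in> I \<Longrightarrow> 0 \<le> q (f i) \<and> q (f i) \<le> 1"
  shows "(\<Prod>i\<in>I. q (f i)) \<le> (\<Prod>x\<in>f ` I. q x)"
  using assms
proof (induction I)
  case (insert i I)
  have nn: "0 \<le> (\<Prod>x\<in>f ` I. q x)" using insert by (intro prod_nonneg) auto
  have IH: "(\<Prod>i\<in>I. q (f i)) \<le> (\<Prod>x\<in>f ` I. q x)" using insert by auto
  show ?case
  proof (cases "f i \<in> f ` I")
    case True
    have "q (f i) * (\<Prod>i\<in>I. q (f i)) \<le> 1 * (\<Prod>x\<in>f ` I. q x)"
      using insert nn IH by (intro mult_mono) (auto intro: prod_nonneg)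
    then show ?thesis using insert True by (simp add: insert_absorb)
  next
    case False
    then show ?thesis using insert IH by (auto intro: mult_left_mono)
  qed
qed simp

text \<open>For fixed signs the product over the edges is the probability that the cycle survives;
  averaging over the signs discards a nonnegative combination of characters and keeps the constant
  \<open>(1 + d^2) ^ (n div 2)\<close>.\<close>

lemma mean_prod_cycle_edges_ge:
  fixes d p :: real
  assumes \<sigma>: "\<sigma> permutes {0..<n}" and r: "3 \<le> r" "r \<le> n" and d: "0 \<le> d" and p: "0 \<le> p"
    and q: "\<And>Y e. e \<in> subsets_of_card r {0..<n} \<Longrightarrow> 0 \<le> p * (1 + d * pair_sign_sum Y e) \<and> p * (1 + d * pair_sign_sum Y e) \<le> 1"
  defines "K \<equiv> subsets_of_card 2 {0..<n}"
  shows "p ^ n * (1 + d\<^sup>2) ^ (n div 2)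
    \<le> (\<Sum>Y\<in>Pow K. bernoulli_weight (\<lambda>_. 1/2) K Y * (\<Prod>e\<in>cycle_edges r n \<sigma>. p * (1 + d * pair_sign_sum Y e)))"
proof -
  let ?w = "cyc_window r n \<sigma>" and ?c = "(1 + d\<^sup>2) ^ (n div 2)"
  have fin: "finite K" by (simp add: K_def finite_subsets_of_card)
  have w: "?w i \<in> subsets_of_card r {0..<n}" for i
    using cyc_window_in_subsets_of_card[OF \<sigma>] r by simp
  then have sub: "?w i \<subseteq> {0..<n}" for i by (auto simp: subsets_of_card_def)
  have "nonneg_char K (\<lambda>Y. pair_sign_sum Y (?w i) * pair_sign_sum Y (?w (Suc i)) - 1)" for i
    using cyc_window_overlap[OF \<sigma>, of r i] r nonneg_char_pair_sign_sum_overlap[OF _ sub sub] by (auto simp: K_def)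
  then have "nonneg_char K (\<lambda>Y. (\<Prod>i<n. 1 + d * pair_sign_sum Y (?w i)) - ?c)"
    using fin d sub by (intro nonneg_char_prod_consecutive) (auto simp: K_def intro: nonneg_char_pair_sign_sum)
  from nonneg_char_mean_nonneg[OF fin this]
  have "?c \<le> (\<Sum>Y\<in>Pow K. bernoulli_weight (\<lambda>_. 1/2) K Y * (\<Prod>i<n. 1 + d * pair_sign_sum Y (?w i)))"
    using sum_bernoulli_weight[OF fin, of "\<lambda>_. 1/2"] by (simp add: right_diff_distrib sum_subtractf sum_distrib_right[symmetric])
  then have "p ^ n * ?c \<le> p ^ n * (\<Sum>Y\<in>Pow K. bernoulli_weight (\<lambda>_. 1/2) K Y * (\<Prod>i<n. 1 + d * pair_sign_sum Y (?w i)))"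
    using p by (intro mult_left_mono) auto
  also have "\<dots> = (\<Sum>Y\<in>Pow K. bernoulli_weight (\<lambda>_. 1/2) K Y * (\<Prod>i<n. p * (1 + d * pair_sign_sum Y (?w i))))"
    by (simp add: sum_distrib_left prod.distrib mult.left_commute)
  also have "\<dots> \<le> (\<Sum>Y\<in>Pow K. bernoulli_weight (\<lambda>_. 1/2) K Y * (\<Prod>e\<in>cycle_edges r n \<sigma>. p * (1 + d * pair_sign_sum Y e)))"
    unfolding cycle_edges_eq using w q
    by (intro sum_mono mult_left_mono prod_image_ge bernoulli_weight_nonneg) auto
  finally show ?thesis .
qed

subsection \<open>Orderings with the same cycle\<close>

lemma cyc_window_no_wrap:
  assumes "i + r \<le> n"
  shows "cyc_window r n \<sigma> i = \<sigma> ` {i..<i + r}"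
proof -
  have "{i..<i + r} = (\<lambda>j. i + j) ` {..<r}"
    by (simp add: lessThan_atLeast0 add.commute)
  then show ?thesis
    using assms by (force simp: cyc_window_def image_image intro!: image_cong)
qed

text \<open>Suppose the orderings agree before position \<open>k = i + r\<close>. The window of
  \<open>\<tau>\<close> at \<open>Suc i\<close> is also a window of \<open>\<sigma>\<close>; it
  contains \<open>\<sigma> (Suc i)\<close> but not \<open>\<sigma> i\<close>, so it must start at
  \<open>Suc i\<close> in \<open>\<sigma>\<close> too. The two windows agree in all but their last
  entries, hence also there.\<close>

lemma permutation_determined_by_cycle:
  assumes \<sigma>: "\<sigma> permutes {0..<n}" and \<tau>: "\<tau> permutes {0..<n}" and r: "2 \<le> r"
    and eq: "cycle_edges r n \<sigma> = cycle_edges r n \<tau>" and init: "\<And>k. k < r \<Longrightarrow> \<sigma> k = \<tau> k"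
  shows "\<sigma> = \<tau>"
proof
  have inj: "\<sigma> x = \<sigma> y \<longleftrightarrow> x = y" "\<tau> x = \<tau> y \<longleftrightarrow> x = y" for x y
    using permutes_inj[OF \<sigma>] permutes_inj[OF \<tau>] by (auto dest: injD)
  fix k
  show "\<sigma> k = \<tau> k"
  proof (induction k rule: less_induct)
    case (less k)
    show ?case
    proof (cases "r \<le> k \<and> k < n")
      case False
      then show ?thesis using init permutes_not_in[OF \<sigma>] permutes_not_in[OF \<tau>] by (metis atLeastLessThan_iff leI)
    next
      case True
      define i where "i = k - r"
      have k: "k = i + r" using True by (simp add: i_def)
      have \<tau>w: "cyc_window r n \<tau> (Suc i) = \<tau> ` {Suc i..<Suc i + r}"
        using True k by (intro cyc_window_no_wrap) auto
      have "cyc_window r n \<tau> (Suc i) \<in> cycle_edges r n \<tau>"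
        unfolding cycle_edges_eq using True k r by auto
      then have "cyc_window r n \<tau> (Suc i) \<in> cycle_edges r n \<sigma>" by (simp add: eq)
      then obtain l where l: "l < n" "cyc_window r n \<sigma> l = \<tau> ` {Suc i..<Suc i + r}"
        unfolding cycle_edges_eq \<tau>w by auto
      \<comment> \<open>Since \<open>r\<close> is at least 2, \<open>Suc i\<close> lies below
        \<open>k\<close>, so the induction hypothesis covers it.\<close>
      have "\<sigma> (Suc i) = \<tau> (Suc i)" "\<sigma> i = \<tau> i" using less k r by auto
      then have "\<sigma> (Suc i) \<in> cyc_window r n \<sigma> l" and ni: "\<sigma> i \<notin> cyc_window r n \<sigma> l"
        using r unfolding l by (auto simp: inj)
      then obtain j where j: "j < r" "(l + j) mod n = Suc i"
        unfolding cyc_window_def by (auto simp: inj)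
      have "j = 0"
      \<comment> \<open>If \<open>\<sigma> (Suc i)\<close> were not the first vertex of the window,
        its predecessor \<open>\<sigma> i\<close> would belong to the window as well.\<close>
      proof (rule ccontr)
        assume "j \<noteq> 0"
        then obtain j' where j': "j = Suc j'" using not0_implies_Suc by blast
        then have "(l + j') mod n = i" using j mod_Suc[of "l + j'" n] by (auto split: if_splits)
        then show False using ni j j' unfolding cyc_window_def by force
      qed
      then have "l = Suc i" using j l by simp
      then have img: "\<sigma> ` {Suc i..<Suc i + r} = \<tau> ` {Suc i..<Suc i + r}"
        using l True k cyc_window_no_wrap[of "Suc i" r n \<sigma>] by auto
      have "\<sigma> k \<in> \<sigma> ` {Suc i..<Suc i + r}" using k r by auto
      then obtain j where "j \<in> {Suc i..<Suc i + r}" "\<sigma> k = \<tau> j" unfolding img by auto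
      then have "j \<le> k" "j < k \<Longrightarrow> \<sigma> k = \<sigma> j" using less k by auto
      then show ?thesis using \<open>\<sigma> k = \<tau> j\<close> inj by (cases "j < k") auto
    qed
  qed
qed

text \<open>A crude multiplicity is enough: a factor polynomial in \<open>n\<close> is absorbed by
  the exponential gain.\<close>

lemma card_hamiltonian_orderings_le:
  assumes "is_rgraph r n G" "2 \<le> r" "r \<le> n"
  shows "card {\<sigma>. \<sigma> permutes {0..<n} \<and> cycle_edges r n \<sigma> \<subseteq> G} \<le> num_ham r n G * n ^ r"
proof -
  let ?P = "{\<sigma>. \<sigma> permutes {0..<n} \<and> cycle_edges r n \<sigma> \<subseteq> G}"
  let ?L = "{xs. set xs \<subseteq> {0..<n} \<and> length xs = r}"
  let ?f = "\<lambda>\<sigma>. (cycle_edges r n \<sigma>, map \<sigma> [0..<r])"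
  have "G \<subseteq> Pow {0..<n}" using assms(1) by (auto simp: is_rgraph_def)
  then have "finite G" by (rule finite_subset) simp
  moreover have "ham_cycles r n G \<subseteq> Pow G" by (auto simp: ham_cycles_def)
  ultimately have fin: "finite (ham_cycles r n G)" by (meson finite_Pow_iff finite_subset)
  have "inj_on ?f ?P"
    using permutation_determined_by_cycle[of _ n _ r] assms(2) by (intro inj_onI) auto
  moreover have "?f ` ?P \<subseteq> ham_cycles r n G \<times> ?L"
  proof
    fix z assume "z \<in> ?f ` ?P"
    then obtain \<sigma> where \<sigma>: "\<sigma> permutes {0..<n}" "cycle_edges r n \<sigma> \<subseteq> G" "z = ?f \<sigma>" by auto
    have "cycle_edges r n \<sigma> \<in> ham_cycles r n G"
      unfolding ham_cycles_def using \<sigma> permutes_imp_bij[OF \<sigma>(1)] by blast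
    then show "z \<in> ham_cycles r n G \<times> ?L"
      using \<sigma> assms(3) permutes_in_image[OF \<sigma>(1)] by auto
  qed
  ultimately have "card ?P \<le> card (ham_cycles r n G \<times> ?L)"
    using fin by (intro card_inj_on_le) (auto simp: finite_lists_length_eq)
  then show ?thesis
    by (simp add: card_cartesian_product card_lists_length_eq num_ham_def)
qed

text \<open>Deletes, one at a time, the edge lying on the fewest of the surviving cycles.\<close>

lemma delete_edges:
  fixes C :: "'p \<Rightarrow> 'e set"
  assumes "finite P" "\<And>x. x \<in> P \<Longrightarrow> card (C x) \<le> n" "0 < m" "n \<le> m" "finite G" "card G = m + k"
  shows "\<exists>G'\<subseteq>G. card G' = m \<and>
    (1 - real n / real m) ^ k * real (card {x\<in>P. C x \<subseteq> G}) \<le> real (card {x\<in>P. C x \<subseteq> G'})"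
  using assms(5,6)
proof (induction k arbitrary: G)
  case 0
  then show ?case by auto
next
  case (Suc k)
  define Q where "Q = {x\<in>P. C x \<subseteq> G}"
  have finQ: "finite Q" using assms(1) by (simp add: Q_def)
  \<comment> \<open>Incidences between edges and surviving cycles are counted in two ways; an edge
    of at most average degree is then deleted.\<close>
  have "(\<Sum>e\<in>G. card {x\<in>Q. e \<in> C x}) = (\<Sum>x\<in>Q. card {e\<in>G. e \<in> C x})"
    using sum.swap_restrict[OF Suc.prems(1) finQ, of "\<lambda>_ _. 1::nat" "\<lambda>e x. e \<in> C x"] by simp
  also have "\<dots> \<le> (\<Sum>x\<in>Q. n)"
  proof (rule sum_mono)
    fix x assume "x \<in> Q"
    then have "{e\<in>G. e \<in> C x} = C x" "x \<in> P" by (auto simp: Q_def)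
    then show "card {e\<in>G. e \<in> C x} \<le> n" using assms(2) by simp
  qed
  finally have total: "(\<Sum>e\<in>G. card {x\<in>Q. e \<in> C x}) \<le> card Q * n" by simp
  have "\<exists>e\<in>G. card {x\<in>Q. e \<in> C x} * card G \<le> card Q * n"
  proof (rule ccontr)
    assume "\<not> ?thesis"
    then have "(\<Sum>e\<in>G. card Q * n) < (\<Sum>e\<in>G. card {x\<in>Q. e \<in> C x} * card G)"
      using Suc.prems assms(3) by (intro sum_strict_mono) (auto simp: not_le)
    then have "card Q * n < (\<Sum>e\<in>G. card {x\<in>Q. e \<in> C x})"
      unfolding sum_constant mult.commute[of _ "card G"] sum_distrib_left[symmetric] mult_less_cancel1
      by simp
    then show False using total by simp
  qed
  then obtain e where e: "e \<in> G" "card {x\<in>Q. e \<in> C x} * card G \<le> card Q * n" by blast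
  have "{x\<in>P. C x \<subseteq> G - {e}} = Q - {x\<in>Q. e \<in> C x}" by (auto simp: Q_def)
  then have "card {x\<in>P. C x \<subseteq> G - {e}} = card Q - card {x\<in>Q. e \<in> C x}"
    using finQ by (simp add: card_Diff_subset)
  moreover have "card {x\<in>Q. e \<in> C x} \<le> card Q" using finQ by (intro card_mono) auto
  \<comment> \<open>Before each deletion \<open>G\<close> still has more than \<open>m\<close>
    edges, so the lost fraction is at most \<open>n / m\<close> in every round.\<close>
  moreover have "real (card {x\<in>Q. e \<in> C x}) \<le> real (card Q) * (real n / real m)"
  proof -
    have "card {x\<in>Q. e \<in> C x} * m \<le> card {x\<in>Q. e \<in> C x} * card G"
      using Suc.prems by (intro mult_left_mono) auto
    then have "card {x\<in>Q. e \<in> C x} * m \<le> card Q * n" using e by linarith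
    then have "real (card {x\<in>Q. e \<in> C x}) * real m \<le> real (card Q) * real n"
      unfolding of_nat_mult[symmetric] of_nat_le_iff .
    then show ?thesis using assms(3) by (simp add: field_simps)
  qed
  ultimately have step: "(1 - real n / real m) * real (card Q) \<le> real (card {x\<in>P. C x \<subseteq> G - {e}})"
    by (simp add: of_nat_diff algebra_simps)
  have "card (G - {e}) = m + k" "finite (G - {e})" using Suc.prems e by auto
  from Suc.IH[OF this(2,1)] obtain G' where G': "G' \<subseteq> G - {e}" "card G' = m"
    "(1 - real n / real m) ^ k * real (card {x\<in>P. C x \<subseteq> G - {e}}) \<le> real (card {x\<in>P. C x \<subseteq> G'})"
    by blast
  have "(1 - real n / real m) ^ Suc k * real (card Q)
      \<le> (1 - real n / real m) ^ k * real (card {x\<in>P. C x \<subseteq> G - {e}})"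
    using mult_left_mono[OF step, of "(1 - real n / real m) ^ k"] assms(3,4)
    by (simp add: mult_ac)
  then show ?case using G' unfolding Q_def by (intro exI[of _ G']) auto
qed

subsection \<open>Existence of the graph\<close>

lemma sum_Bex_le:
  fixes w :: "'a \<Rightarrow> real"
  assumes "finite F" "finite A" "\<And>x. x \<in> A \<Longrightarrow> 0 \<le> w x"
  shows "(\<Sum>x | x \<in> A \<and> (\<exists>T\<in>F. P T x). w x) \<le> (\<Sum>T\<in>F. \<Sum>x | x \<in> A \<and> P T x. w x)"
  using assms(1)
proof induction
  case (insert T F)
  have "{x. x \<in> A \<and> (\<exists>T\<in>insert T F. P T x)} = {x. x \<in> A \<and> P T x} \<union> {x. x \<in> A \<and> (\<exists>T\<in>F. P T x)}"
    by auto
  moreover have "sum w ({x. x \<in> A \<and> P T x} \<union> {x. x \<in> A \<and> (\<exists>T\<in>F. P T x)})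
      \<le> sum w {x. x \<in> A \<and> P T x} + sum w {x. x \<in> A \<and> (\<exists>T\<in>F. P T x)}"
    using assms by (intro sum_Un_le) auto
  ultimately show ?case using insert by simp
qed simp

lemma sum_product_filter:
  fixes w :: "'a \<Rightarrow> 'b \<Rightarrow> real"
  assumes "finite A" "finite B"
  shows "(\<Sum>x | x \<in> A \<times> B \<and> P (fst x) (snd x). w (fst x) (snd x)) = (\<Sum>a\<in>A. \<Sum>b | b \<in> B \<and> P a b. w a b)"
proof -
  have "{x. x \<in> A \<times> B \<and> P (fst x) (snd x)} = Sigma A (\<lambda>a. {b. b \<in> B \<and> P a b})" by auto
  then show ?thesis using assms by (simp add: sum.Sigma case_prod_unfold)
qed

text \<open>First the set \<open>Y\<close> of positive pairs is drawn uniformly, then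
  \<open>G\<close> with edge probabilities \<open>q Y\<close>. The expected number of surviving
  members of \<open>P\<close> is at least \<open>card P * a\<close>, the number never exceeds
  \<open>card P\<close>, and all concentration failures together have probability at most
  \<open>b\<close>; averaging off the failures gives the outcome.\<close>

lemma two_stage_exists:
  fixes q :: "'a set \<Rightarrow> 'b \<Rightarrow> real" and C :: "'p \<Rightarrow> 'b set" and a b t :: real and N :: nat
  assumes K: "finite K" and E: "finite E" and P: "finite P"
    and q: "\<And>Y e. e \<in> E \<Longrightarrow> 0 \<le> q Y e \<and> q Y e \<le> 1"
    and C: "\<And>x. x \<in> P \<Longrightarrow> C x \<subseteq> E"
    and mean: "\<And>x. x \<in> P \<Longrightarrow> a \<le> (\<Sum>Y\<in>Pow K. bernoulli_weight (\<lambda>_. 1/2) K Y * (\<Prod>e\<in>C x. q Y e))"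
    and F: "finite F" "\<And>T. T \<in> F \<Longrightarrow> T \<subseteq> E" "\<And>T. T \<in> F \<Longrightarrow> N \<le> card T"
    and t: "0 \<le> t" "t \<le> 1"
    and b: "2 * exp (- (t\<^sup>2 * card K / 4)) + card F * (2 * exp (- (t\<^sup>2 * N / 4))) \<le> b"
    and ba: "b < a" and ne: "P \<noteq> {}"
  shows "\<exists>Y G. Y \<subseteq> K \<and> G \<subseteq> E \<and> \<bar>real (card Y) - card K / 2\<bar> \<le> t * card K \<and>
    (\<forall>T\<in>F. \<bar>real (card (G \<inter> T)) - sum (q Y) T\<bar> \<le> t * card T) \<and>
    card P * (a - b) \<le> card {x\<in>P. C x \<subseteq> G}"
proof -
  define w where "w Y G = bernoulli_weight (\<lambda>_. 1/2) K Y * bernoulli_weight (q Y) E G" for Y G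
  define f where "f G = real (card {x\<in>P. C x \<subseteq> G})" for G
  define B1 where "B1 Y \<longleftrightarrow> \<bar>real (card (Y \<inter> K)) - sum (\<lambda>_. 1/2) K\<bar> \<ge> t * card K" for Y
  define B2 where "B2 Y G \<longleftrightarrow> (\<exists>T\<in>F. \<bar>real (card (G \<inter> T)) - sum (q Y) T\<bar> \<ge> t * card T)" for Y G
  let ?\<Omega> = "Pow K \<times> Pow E"
  have wK: "0 \<le> bernoulli_weight (\<lambda>_. 1/2) K Y" if "Y \<in> Pow K" for Y
    using that by (intro bernoulli_weight_nonneg) auto
  have wE: "0 \<le> bernoulli_weight (q Y) E G" if "G \<in> Pow E" for Y G
    using that q by (intro bernoulli_weight_nonneg) auto
  have w: "0 \<le> w (fst x) (snd x)" if "x \<in> ?\<Omega>" for x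
    using that wK[of "fst x"] wE[of "snd x"] by (auto simp: w_def)
  have fib: "(\<Sum>G\<in>Pow E. w Y G * g G) = bernoulli_weight (\<lambda>_. 1/2) K Y * (\<Sum>G\<in>Pow E. bernoulli_weight (q Y) E G * g G)" for Y and g :: "'b set \<Rightarrow> real"
    by (simp add: w_def sum_distrib_left mult.assoc)
  have all: "(\<Sum>x\<in>?\<Omega>. w (fst x) (snd x) * g (snd x))
      = (\<Sum>Y\<in>Pow K. bernoulli_weight (\<lambda>_. 1/2) K Y * (\<Sum>G\<in>Pow E. bernoulli_weight (q Y) E G * g G))" for g :: "'b set \<Rightarrow> real"
    unfolding fib[symmetric] by (simp add: sum.cartesian_product case_prod_unfold)
  have total: "(\<Sum>x\<in>?\<Omega>. w (fst x) (snd x)) = 1"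
    using all[of "\<lambda>_. 1"] sum_bernoulli_weight[OF E] sum_bernoulli_weight[OF K] by simp
  have "card P * a \<le> (\<Sum>x\<in>P. \<Sum>Y\<in>Pow K. bernoulli_weight (\<lambda>_. 1/2) K Y * (\<Prod>e\<in>C x. q Y e))"
    using sum_mono[of P "\<lambda>_. a", OF mean] by simp
  \<comment> \<open>Each product is the conditional probability that \<open>C x\<close> lies in
    \<open>G\<close>. Exchanging sums then turns the total into the mean of
    \<open>f\<close>.\<close>
  also have "\<dots> = (\<Sum>x\<in>P. \<Sum>Y\<in>Pow K. bernoulli_weight (\<lambda>_. 1/2) K Y * (\<Sum>G\<in>Pow E. bernoulli_weight (q Y) E G * of_bool (C x \<subseteq> G)))"
    by (intro sum.cong refl) (simp only: sum_bernoulli_weight_superset[OF E C])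
  also have "\<dots> = (\<Sum>Y\<in>Pow K. \<Sum>x\<in>P. bernoulli_weight (\<lambda>_. 1/2) K Y * (\<Sum>G\<in>Pow E. bernoulli_weight (q Y) E G * of_bool (C x \<subseteq> G)))"
    by (rule sum.swap)
  also have "\<dots> = (\<Sum>Y\<in>Pow K. bernoulli_weight (\<lambda>_. 1/2) K Y * (\<Sum>x\<in>P. \<Sum>G\<in>Pow E. bernoulli_weight (q Y) E G * of_bool (C x \<subseteq> G)))"
    by (simp add: sum_distrib_left)
  also have "\<dots> = (\<Sum>Y\<in>Pow K. bernoulli_weight (\<lambda>_. 1/2) K Y * (\<Sum>G\<in>Pow E. \<Sum>x\<in>P. bernoulli_weight (q Y) E G * of_bool (C x \<subseteq> G)))"
    by (subst sum.swap[of _ P]) (rule refl)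
  also have "\<dots> = (\<Sum>Y\<in>Pow K. bernoulli_weight (\<lambda>_. 1/2) K Y * (\<Sum>G\<in>Pow E. bernoulli_weight (q Y) E G * f G))"
    using P by (simp add: f_def sum_distrib_left[symmetric] Int_def)
  finally have lower: "card P * a \<le> (\<Sum>x\<in>?\<Omega>. w (fst x) (snd x) * f (snd x))"
    unfolding all .
  have bad1: "(\<Sum>x | x \<in> ?\<Omega> \<and> B1 (fst x). w (fst x) (snd x)) \<le> 2 * exp (- (t\<^sup>2 * card K / 4))"
  proof -
    have "(\<Sum>x | x \<in> ?\<Omega> \<and> B1 (fst x). w (fst x) (snd x)) = (\<Sum>Y\<in>Pow K. \<Sum>G | G \<in> Pow E \<and> B1 Y. w Y G)"
      using K E by (intro sum_product_filter) auto
    also have "\<dots> = (\<Sum>Y\<in>Pow K. if B1 Y then \<Sum>G\<in>Pow E. w Y G else 0)"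
      by (intro sum.cong) (auto simp: Pow_def)
    also have "\<dots> = (\<Sum>Y\<in>Pow K. if B1 Y then bernoulli_weight (\<lambda>_. 1/2) K Y else 0)"
      using fib[of _ "\<lambda>_. 1"] sum_bernoulli_weight[OF E] by (simp cong: if_cong)
    also have "\<dots> = (\<Sum>Y | Y \<in> Pow K \<and> B1 Y. bernoulli_weight (\<lambda>_. 1/2) K Y)"
      by (rule sum.inter_filter[symmetric]) (use K in simp)
    also have "\<dots> \<le> 2 * exp (- (t\<^sup>2 * card K / 4))"
      using chernoff[of K K "\<lambda>_. 1/2" t] K t by (simp add: B1_def)
    finally show ?thesis .
  qed
  have bad2: "(\<Sum>x | x \<in> ?\<Omega> \<and> B2 (fst x) (snd x). w (fst x) (snd x)) \<le> card F * (2 * exp (- (t\<^sup>2 * N / 4)))"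
    (is "_ \<le> ?\<beta>")
  proof -
    \<comment> \<open>For every fixed \<open>Y\<close> a union bound over \<open>F\<close> applies.
      The bound does not depend on \<open>Y\<close>, so it survives averaging over the
      signs.\<close>
    have "(\<Sum>G | G \<in> Pow E \<and> B2 Y G. bernoulli_weight (q Y) E G) \<le> ?\<beta>" for Y
    proof -
      have "(\<Sum>G | G \<in> Pow E \<and> B2 Y G. bernoulli_weight (q Y) E G)
          \<le> (\<Sum>T\<in>F. \<Sum>G | G \<in> Pow E \<and> \<bar>real (card (G \<inter> T)) - sum (q Y) T\<bar> \<ge> t * card T. bernoulli_weight (q Y) E G)"
        unfolding B2_def using F E wE by (intro sum_Bex_le) auto
      also have "\<dots> \<le> (\<Sum>T\<in>F. 2 * exp (- (t\<^sup>2 * N / 4)))"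
      proof (rule sum_mono)
        fix T assume T: "T \<in> F"
        have "(\<Sum>G | G \<in> Pow E \<and> \<bar>real (card (G \<inter> T)) - sum (q Y) T\<bar> \<ge> t * card T. bernoulli_weight (q Y) E G)
            \<le> 2 * exp (- (t\<^sup>2 * card T / 4))"
          using chernoff[OF E F(2)[OF T] q t] by simp
        also have "\<dots> \<le> 2 * exp (- (t\<^sup>2 * N / 4))"
          using mult_left_mono[of "real N" "real (card T)" "t\<^sup>2"] F(3)[OF T] by simp
        finally show "(\<Sum>G | G \<in> Pow E \<and> \<bar>real (card (G \<inter> T)) - sum (q Y) T\<bar> \<ge> t * card T. bernoulli_weight (q Y) E G)
            \<le> 2 * exp (- (t\<^sup>2 * N / 4))" .
      qed
      finally show ?thesis by simp
    qed
    then have "(\<Sum>Y\<in>Pow K. bernoulli_weight (\<lambda>_. 1/2) K Y * (\<Sum>G | G \<in> Pow E \<and> B2 Y G. bernoulli_weight (q Y) E G))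
        \<le> (\<Sum>Y\<in>Pow K. bernoulli_weight (\<lambda>_. 1/2) K Y * ?\<beta>)"
      using wK by (intro sum_mono mult_left_mono) auto
    also have "\<dots> = ?\<beta>"
      using sum_bernoulli_weight[OF K, of "\<lambda>_. 1/2"] by (simp only: sum_distrib_right[symmetric] mult_1)
    finally show ?thesis
      using K E sum_product_filter[of "Pow K" "Pow E" w B2] by (simp add: w_def sum_distrib_left)
  qed
  have "(\<Sum>x | x \<in> ?\<Omega> \<and> (B1 (fst x) \<or> B2 (fst x) (snd x)). w (fst x) (snd x))
      = sum (\<lambda>x. w (fst x) (snd x)) ({x. x \<in> ?\<Omega> \<and> B1 (fst x)} \<union> {x. x \<in> ?\<Omega> \<and> B2 (fst x) (snd x)})"
    by (intro sum.cong) auto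
  also have "\<dots> \<le> (\<Sum>x | x \<in> ?\<Omega> \<and> B1 (fst x). w (fst x) (snd x))
      + (\<Sum>x | x \<in> ?\<Omega> \<and> B2 (fst x) (snd x). w (fst x) (snd x))"
    using K E w by (intro sum_Un_le finite_Collect_conjI) auto
  also have "\<dots> \<le> b" using bad1 bad2 b by linarith
  finally have bad: "(\<Sum>x | x \<in> ?\<Omega> \<and> (B1 (fst x) \<or> B2 (fst x) (snd x)). w (fst x) (snd x)) \<le> b" .
  have "f G \<le> card P" for G unfolding f_def using P by (simp add: card_mono)
  moreover have "card P * b < card P * a" using ba ne P by (simp add: card_gt_0_iff)
  ultimately obtain x where x: "x \<in> ?\<Omega>" "\<not> (B1 (fst x) \<or> B2 (fst x) (snd x))" "card P * a - card P * b \<le> f (snd x)"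
    using weighted_average_avoiding[of ?\<Omega> "\<lambda>x. w (fst x) (snd x)" "\<lambda>x. f (snd x)" "card P" "card P * a"
      "\<lambda>x. B1 (fst x) \<or> B2 (fst x) (snd x)" b] K E w total lower bad by auto
  show ?thesis
  proof (intro exI[of _ "fst x"] exI[of _ "snd x"] conjI)
    have "fst x \<inter> K = fst x" using x(1) by auto
    then show "\<bar>real (card (fst x)) - card K / 2\<bar> \<le> t * card K"
      using x(2) by (simp add: B1_def)
    show "\<forall>T\<in>F. \<bar>real (card (snd x \<inter> T)) - sum (q (fst x)) T\<bar> \<le> t * card T"
      using x(2) by (force simp: B2_def)
    show "card P * (a - b) \<le> card {y \<in> P. C y \<subseteq> snd x}"
      using x(3) by (simp add: f_def right_diff_distrib)
  qed (use x(1) in auto)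
qed

text \<open>The number of edges is not yet exact, and its two bounds differ on purpose. A surplus
  will have to be deleted at the cost of cycles, so it is controlled with the fine parameter
  \<open>t\<close>; a deficit can be filled at no cost, and the coarse \<open>\<kappa>\<close>
  suffices.\<close>

lemma exists_weakly_quasi_random:
  fixes p d t \<kappa> :: real and r n :: nat
  defines "h \<equiv> n div 2" and "V \<equiv> {0..<n}"
  assumes r: "3 \<le> r" "r \<le> h" and p: "0 < p" "p < 1"
    and d: "0 \<le> d" "d * real (r choose 2) \<le> 1/2" "p * (1 + d * real (r choose 2)) \<le> 1"
      "d * real (r choose 2) \<le> \<kappa>"
    and t: "0 \<le> t" "t \<le> 1" "t \<le> \<kappa>"
    and bad: "2 * exp (- (t\<^sup>2 * real (n choose 2) / 4)) + 2 ^ (n + 1) * (2 * exp (- (t\<^sup>2 * real (h choose r) / 4))) \<le> p ^ n / 2"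
  shows "\<exists>G\<subseteq>subsets_of_card r V.
      real (card G) \<le> p * real (n choose r) + 2 * t * real (n choose r) \<and>
      real (card G) \<ge> p * real (n choose r) - 2 * \<kappa> * real (n choose r) \<and>
      (\<forall>W. W \<subseteq> V \<and> card W = h \<longrightarrow>
        \<bar>real (card (induced G W)) - p * real (h choose r)\<bar> \<le> 2 * \<kappa> * real (h choose r)) \<and>
      fact n * p ^ n * ((1 + d\<^sup>2) ^ (n div 2) - 1/2) \<le> real (card {\<sigma>. \<sigma> permutes V \<and> cycle_edges r n \<sigma> \<subseteq> G})"
proof -
  define D where "D = real (r choose 2)"
  define K where "K = subsets_of_card 2 V"
  define E where "E = subsets_of_card r V"
  define q where "q Y e = p * (1 + d * pair_sign_sum Y e)" for Y and e :: "nat set"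
  \<comment> \<open>The test families: all \<open>r\<close>-sets, for the edge count, and the
    \<open>r\<close>-sets inside each half-size vertex set, for quasi-randomness.\<close>
  define F where "F = insert E (subsets_of_card r ` subsets_of_card h V)"
  define P where "P = {\<sigma>. \<sigma> permutes V}"
  have hn: "h \<le> n" "r \<le> n" "0 < n" using r by (auto simp: h_def)
  have fV: "finite V" "card V = n" by (auto simp: V_def)
  have fK: "finite K" "card K = n choose 2" and fE: "finite E" "card E = n choose r"
    unfolding K_def E_def using fV by (simp_all add: finite_subsets_of_card card_subsets_of_card)
  have fP: "finite P" "card P = fact n"
    unfolding P_def using fV by (auto simp: finite_permutations card_permutations)
  have Pne: "P \<noteq> {}" unfolding P_def using permutes_id by blast
  have D: "0 \<le> D" by (simp add: D_def)
  have g: "\<bar>d * pair_sign_sum Y e\<bar> \<le> d * D" if "e \<in> E" for Y e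
  proof -
    have "finite e" "card e = r" using that fV by (auto simp: E_def subsets_of_card_def dest: finite_subset)
    then show ?thesis using abs_pair_sign_sum_le[of e Y] d(1) by (simp add: D_def abs_mult mult_left_mono)
  qed
  have q: "0 \<le> q Y e \<and> q Y e \<le> 1 \<and> \<bar>q Y e - p\<bar> \<le> \<kappa>" if "e \<in> E" for Y e
  proof (intro conjI)
    have "\<bar>d * pair_sign_sum Y e\<bar> \<le> d * D" "d * D \<le> 1/2" "d * D \<le> \<kappa>" using g[OF that] d by (auto simp: D_def)
    then have s: "- (1/2) \<le> d * pair_sign_sum Y e" "d * pair_sign_sum Y e \<le> d * D" "\<bar>d * pair_sign_sum Y e\<bar> \<le> \<kappa>" by linarith+
    show "0 \<le> q Y e" unfolding q_def using p s by (intro mult_nonneg_nonneg) linarith+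
    have "q Y e \<le> p * (1 + d * D)" unfolding q_def using p s by (intro mult_left_mono) linarith+
    then show "q Y e \<le> 1" using d by (simp add: D_def)
    have "\<bar>q Y e - p\<bar> = p * \<bar>d * pair_sign_sum Y e\<bar>" using p by (simp add: q_def algebra_simps abs_mult)
    also have "\<dots> \<le> 1 * \<kappa>" using p s by (intro mult_mono) auto
    finally show "\<bar>q Y e - p\<bar> \<le> \<kappa>" by simp
  qed
  have sumq: "\<bar>sum (q Y) T - p * card T\<bar> \<le> \<kappa> * card T" if "T \<subseteq> E" for Y T
  proof -
    have "\<bar>sum (q Y) T - p * card T\<bar> = \<bar>\<Sum>e\<in>T. q Y e - p\<bar>" by (simp add: sum_subtractf mult.commute)
    also have "\<dots> \<le> (\<Sum>e\<in>T. \<bar>q Y e - p\<bar>)" by (rule sum_abs)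
    also have "\<dots> \<le> (\<Sum>e\<in>T. \<kappa>)" using q that by (intro sum_mono) auto
    finally show ?thesis by (simp add: mult.commute)
  qed
  have fF: "finite F" unfolding F_def using fV by (simp add: finite_subsets_of_card)
  have FE: "T \<subseteq> E" if "T \<in> F" for T
    using that by (auto simp: F_def E_def subsets_of_card_def)
  have cardW: "card (subsets_of_card r W) = h choose r" if "W \<in> subsets_of_card h V" for W
    using that fV card_subsets_of_card[of W r] by (auto simp: subsets_of_card_def dest: finite_subset)
  have FN: "h choose r \<le> card T" if "T \<in> F" for T
    using that cardW fE binomial_right_mono[OF hn(1), of r] by (auto simp: F_def)
  have cardF: "card F \<le> 2 ^ (n + 1)"
  proof -
    have "subsets_of_card h V \<subseteq> Pow V" by (auto simp: subsets_of_card_def)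
    then have "card (subsets_of_card h V) \<le> 2 ^ n"
      using card_mono[of "Pow V" "subsets_of_card h V"] fV by (simp add: card_Pow)
    moreover have "card (subsets_of_card r ` subsets_of_card h V) \<le> card (subsets_of_card h V)"
      using fV by (intro card_image_le finite_subsets_of_card)
    moreover have "card F \<le> Suc (card (subsets_of_card r ` subsets_of_card h V))"
      unfolding F_def by (rule card_insert_le_m1) simp_all
    moreover have "1 \<le> (2::nat) ^ n" by (rule one_le_power) simp
    ultimately have "card F \<le> 2 ^ n + 2 ^ n" by linarith
    then show ?thesis by simp
  qed
  have "\<exists>Y G. Y \<subseteq> K \<and> G \<subseteq> E \<and> \<bar>real (card Y) - card K / 2\<bar> \<le> t * card K \<and>
    (\<forall>T\<in>F. \<bar>real (card (G \<inter> T)) - sum (q Y) T\<bar> \<le> t * card T) \<and>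
    card P * (p ^ n * (1 + d\<^sup>2) ^ (n div 2) - p ^ n / 2) \<le> card {\<sigma>\<in>P. cycle_edges r n \<sigma> \<subseteq> G}"
  proof (rule two_stage_exists[OF fK(1) fE(1) fP(1) _ _ _ fF FE FN t(1,2) _ _ Pne])
    show "0 \<le> q Y e \<and> q Y e \<le> 1" if "e \<in> E" for Y e using q[OF that] by auto
    show "cycle_edges r n \<sigma> \<subseteq> E" if "\<sigma> \<in> P" for \<sigma>
      using that hn cyc_window_in_subsets_of_card[of \<sigma> n r] by (auto simp: cycle_edges_eq P_def E_def V_def)
    show "p ^ n * (1 + d\<^sup>2) ^ (n div 2) \<le> (\<Sum>Y\<in>Pow K. bernoulli_weight (\<lambda>_. 1/2) K Y * (\<Prod>e\<in>cycle_edges r n \<sigma>. q Y e))"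
      if "\<sigma> \<in> P" for \<sigma>
      unfolding q_def K_def V_def
      using that r hn d p q by (intro mean_prod_cycle_edges_ge) (auto simp: P_def V_def E_def q_def)
    have "card F * (2 * exp (- (t\<^sup>2 * (h choose r) / 4))) \<le> 2 ^ (n + 1) * (2 * exp (- (t\<^sup>2 * real (h choose r) / 4)))"
      using of_nat_mono[OF cardF, where 'a = real] by (intro mult_right_mono) auto
    then show "2 * exp (- (t\<^sup>2 * card K / 4)) + card F * (2 * exp (- (t\<^sup>2 * (h choose r) / 4))) \<le> p ^ n / 2"
      using bad unfolding fK(2) by linarith
    have "1 \<le> (1 + d\<^sup>2) ^ (n div 2)" by (simp add: one_le_power)
    then have "p ^ n * 1 \<le> p ^ n * (1 + d\<^sup>2) ^ (n div 2)" using p by (intro mult_left_mono) auto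
    moreover have "0 < p ^ n" using p by simp
    ultimately show "p ^ n / 2 < p ^ n * (1 + d\<^sup>2) ^ (n div 2)" by linarith
  qed
  then obtain Y G where Y: "Y \<subseteq> K" "\<bar>real (card Y) - card K / 2\<bar> \<le> t * card K" and G: "G \<subseteq> E"
    and GT: "\<And>T. T \<in> F \<Longrightarrow> \<bar>real (card (G \<inter> T)) - sum (q Y) T\<bar> \<le> t * card T"
    and cnt: "card P * (p ^ n * (1 + d\<^sup>2) ^ (n div 2) - p ^ n / 2) \<le> card {\<sigma>\<in>P. cycle_edges r n \<sigma> \<subseteq> G}"
    by blast
  let ?N = "real (n choose r)"
  have GE: "\<bar>real (card G) - sum (q Y) E\<bar> \<le> t * ?N"
    using GT[of E] G fE by (simp add: F_def Int_absorb2)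
  \<comment> \<open>The crude estimate \<open>sumq\<close> would only give an error
    \<open>\<kappa>\<close> here. Concentration of \<open>card Y\<close> bounds the sum of all signs
    by \<open>2 * t * card K\<close>, so the edge probabilities exceed \<open>p\<close> by at most
    \<open>t\<close> on average.\<close>
  have "(\<Sum>e\<in>E. pair_sign_sum Y e) = real ((n - 2) choose (r - 2)) * (2 * real (card Y) - real (card K))"
    unfolding E_def using sum_pair_sign_sum[of V r Y] fV r sum_mem_sign[OF fK(1) Y(1)] by (simp add: K_def)
  also have "\<dots> \<le> real ((n - 2) choose (r - 2)) * (2 * t * real (card K))"
    using Y(2) by (intro mult_left_mono) linarith+
  also have "\<dots> = 2 * t * D * ?N"
  proof -
    have "(n choose r) * (r choose 2) = (n choose 2) * ((n - 2) choose (r - 2))"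
      using r hn by (intro choose_mult) auto
    then have "?N * D = real (n choose 2) * real ((n - 2) choose (r - 2))"
      unfolding D_def of_nat_mult[symmetric] by simp
    then show ?thesis unfolding fK(2) by (simp add: mult_ac)
  qed
  finally have "d * (\<Sum>e\<in>E. pair_sign_sum Y e) \<le> d * (2 * t * D * ?N)"
    using d(1) by (rule mult_left_mono)
  also have "\<dots> = 2 * (d * D) * (t * ?N)" by simp
  also have "\<dots> \<le> 1 * (t * ?N)" using d t by (intro mult_right_mono) (auto simp: D_def)
  finally have "p * (d * (\<Sum>e\<in>E. pair_sign_sum Y e)) \<le> p * (t * ?N)" using p by (intro mult_left_mono) auto
  also have "\<dots> \<le> 1 * (t * ?N)" using p t by (intro mult_right_mono) auto
  finally have "sum (q Y) E \<le> p * ?N + t * ?N"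
    unfolding q_def by (simp add: distrib_left sum.distrib sum_distrib_left[symmetric] fE mult.commute)
  then have up: "real (card G) \<le> p * ?N + 2 * t * ?N" using GE by linarith
  have tk: "t * real x \<le> \<kappa> * real x" for x using t by (intro mult_right_mono) auto
  have low: "real (card G) \<ge> p * ?N - 2 * \<kappa> * ?N"
    using GE sumq[of E Y] fE tk[of "n choose r"] by simp
  have "\<bar>real (card (induced G W)) - p * real (h choose r)\<bar> \<le> 2 * \<kappa> * real (h choose r)"
    if "W \<subseteq> V" "card W = h" for W
  proof -
    have W: "W \<in> subsets_of_card h V" using that by (simp add: subsets_of_card_def)
    have "induced G W = G \<inter> subsets_of_card r W"
      using G by (auto simp: induced_def E_def subsets_of_card_def)
    moreover have "subsets_of_card r W \<in> F" using W by (auto simp: F_def)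
    ultimately show ?thesis
      using GT[of "subsets_of_card r W"] sumq[of "subsets_of_card r W" Y] FE cardW[OF W] tk[of "h choose r"]
      by simp
  qed
  moreover have "fact n * p ^ n * ((1 + d\<^sup>2) ^ (n div 2) - 1/2) \<le> real (card {\<sigma>. \<sigma> permutes V \<and> cycle_edges r n \<sigma> \<subseteq> G})"
    using cnt fP(2) by (simp add: P_def algebra_simps)
  ultimately show ?thesis using G up low unfolding E_def by blast
qed

text \<open>Edges are added or deleted until there are exactly \<open>m\<close>. The changed edges
  could all lie inside one \<open>W\<close>, so \<open>\<kappa>\<close> is scaled down by the bound
  \<open>B\<close> on the ratio of \<open>n choose r\<close> to \<open>h choose r\<close>.\<close>

lemma exists_quasi_random:
  fixes p d t \<epsilon> B :: real and r n m :: nat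
  defines "h \<equiv> n div 2" and "\<kappa> \<equiv> \<epsilon> / (8 * B)"
  assumes r: "3 \<le> r" "r \<le> h" and p: "0 < p" "p < 1" and \<epsilon>: "0 < \<epsilon>"
    and d: "0 \<le> d" "d * real (r choose 2) \<le> 1/2" "p * (1 + d * real (r choose 2)) \<le> 1"
      "d * real (r choose 2) \<le> \<kappa>"
    and t: "0 \<le> t" "t \<le> 1" "t \<le> \<kappa>" "32 * t \<le> p * d\<^sup>2"
    and bad: "2 * exp (- (t\<^sup>2 * real (n choose 2) / 4)) + 2 ^ (n + 1) * (2 * exp (- (t\<^sup>2 * real (h choose r) / 4))) \<le> p ^ n / 2"
    and B: "1 \<le> B" "real (n choose r) \<le> B * real (h choose r)"
    and m: "real m = p * real (n choose r)" "2 * n \<le> m"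
  shows "\<exists>G. quasi_random r n \<epsilon> p G \<and>
    exp (- (d\<^sup>2 * n / 8)) * (fact n * p ^ n * ((1 + d\<^sup>2) ^ (n div 2) - 1/2))
      \<le> real (card {\<sigma>. \<sigma> permutes {0..<n} \<and> cycle_edges r n \<sigma> \<subseteq> G})"
proof -
  let ?N = "real (n choose r)" and ?Nh = "real (h choose r)" and ?E = "subsets_of_card r {0..<n}"
  let ?cnt = "\<lambda>G. real (card {\<sigma>. \<sigma> permutes {0..<n} \<and> cycle_edges r n \<sigma> \<subseteq> G})"
  let ?X = "fact n * p ^ n * ((1 + d\<^sup>2) ^ (n div 2) - 1/2)"
  have \<kappa>: "0 < \<kappa>" "8 * B * \<kappa> = \<epsilon>" using \<epsilon> B by (auto simp: \<kappa>_def)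
  have n: "0 < n" "0 < m" using r m by (auto simp: h_def)
  have Nh: "0 < ?Nh" using r by simp
  obtain G where G: "G \<subseteq> ?E" and up: "real (card G) \<le> p * ?N + 2 * t * ?N"
    and low: "real (card G) \<ge> p * ?N - 2 * \<kappa> * ?N"
    and GW: "\<And>W. W \<subseteq> {0..<n} \<Longrightarrow> card W = h \<Longrightarrow> \<bar>real (card (induced G W)) - p * ?Nh\<bar> \<le> 2 * \<kappa> * ?Nh"
    and cnt: "?X \<le> ?cnt G"
    using exists_weakly_quasi_random[OF r(1) r(2)[unfolded h_def] p d t(1-3) bad[unfolded h_def]]
    unfolding h_def[symmetric] by blast
  have fE: "finite ?E" "card ?E = n choose r" by (simp_all add: finite_subsets_of_card card_subsets_of_card)
  have fG: "finite G" using G fE finite_subset by blast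
  have "1 \<le> (1 + d\<^sup>2) ^ (n div 2)" by (rule one_le_power) simp
  then have "0 \<le> (1 + d\<^sup>2) ^ (n div 2) - 1/2" by linarith
  then have X: "0 \<le> ?X" using p by (intro mult_nonneg_nonneg) simp_all
  have e1: "exp (- (d\<^sup>2 * n / 8)) * ?X \<le> ?X"
    using X by (intro mult_left_le_one_le) auto
  have finite_perms: "finite {\<sigma>. \<sigma> permutes {0..<n}}" by (simp add: finite_permutations)
  have card_edges: "card (cycle_edges r n \<sigma>) \<le> n" for \<sigma>
    unfolding cycle_edges_eq using card_image_le[of "{..<n}" "cyc_window r n \<sigma>"] by simp
  have "\<exists>G'. card G' = m \<and> G' \<subseteq> ?E \<and> (G \<subseteq> G' \<or> G' \<subseteq> G) \<and> exp (- (d\<^sup>2 * n / 8)) * ?X \<le> ?cnt G'"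
  proof (cases "card G \<le> m")
    case True
    have "p * ?N \<le> 1 * ?N" using p by (intro mult_right_mono) auto
    then have "m \<le> card ?E" using m fE by simp
    then obtain G' where G': "G \<subseteq> G'" "G' \<subseteq> ?E" "card G' = m"
      using exists_subset_between[OF True _ G fE(1)] by blast
    \<comment> \<open>Adding edges destroys no cycle.\<close>
    have "?cnt G \<le> ?cnt G'"
      using G' finite_perms by (intro of_nat_mono card_mono) auto
    then show ?thesis using G' cnt e1 by (intro exI[of _ G']) linarith
  next
    case False
    define k where "k = card G - m"
    have k: "card G = m + k" using False by (simp add: k_def)
    have "\<exists>G'\<subseteq>G. card G' = m \<and>
      (1 - real n / real m) ^ k * real (card {x \<in> {\<sigma>. \<sigma> permutes {0..<n}}. cycle_edges r n x \<subseteq> G})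
        \<le> real (card {x \<in> {\<sigma>. \<sigma> permutes {0..<n}}. cycle_edges r n x \<subseteq> G'})"
      using delete_edges[OF finite_perms _ n(2) _ fG k] card_edges m by simp
    then obtain G' where G': "G' \<subseteq> G" "card G' = m" "(1 - real n / real m) ^ k * ?cnt G \<le> ?cnt G'" by auto
    define x where "x = real n / real m"
    have x: "0 \<le> x" "x \<le> 1/2" using m n by (auto simp: x_def field_simps)
    \<comment> \<open>With \<open>x \<le> 1/2\<close>, which comes from
      \<open>2 * n \<le> m\<close>, each deletion keeps at least a factor
      \<open>exp (- 2 * x)\<close>.\<close>
    have "- 2 * x \<le> - x - 2 * x\<^sup>2"
      using x mult_right_mono[of x "1/2" x] by (simp add: power2_eq_square)
    also have "\<dots> \<le> ln (1 - x)" using x by (intro ln_one_minus_pos_lower_bound)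
    finally have "exp (- 2 * x) \<le> 1 - x" using x by (simp add: ln_ge_iff)
    then have "exp (- 2 * x) ^ k \<le> (1 - x) ^ k" by (intro power_mono) auto
    moreover have "exp (- (d\<^sup>2 * n / 8)) \<le> exp (- 2 * x) ^ k"
    proof -
      \<comment> \<open>The surplus \<open>k\<close> is at most \<open>2 * t * ?N\<close>, and
        \<open>32 * t \<le> p * d^2\<close> makes this at most \<open>d^2 * m / 16\<close>.\<close>
      have "16 * real k \<le> 32 * t * ?N" using up k m by simp
      also have "\<dots> \<le> p * d\<^sup>2 * ?N" using t by (intro mult_right_mono) auto
      also have "\<dots> = d\<^sup>2 * m" using m by simp
      finally have "16 * real k * real n \<le> d\<^sup>2 * m * real n" by (intro mult_right_mono) auto
      then have "2 * x * k \<le> d\<^sup>2 * n / 8" using n by (simp add: x_def field_simps)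
      then show ?thesis by (simp add: exp_of_nat_mult[symmetric] mult_ac)
    qed
    ultimately have "exp (- (d\<^sup>2 * n / 8)) \<le> (1 - x) ^ k" by linarith
    then have "exp (- (d\<^sup>2 * n / 8)) * ?X \<le> (1 - x) ^ k * ?cnt G"
      using cnt X x by (intro mult_mono) auto
    then show ?thesis using G' G by (intro exI[of _ G']) (auto simp: x_def)
  qed
  then obtain G' where G': "card G' = m" "G' \<subseteq> ?E" "G \<subseteq> G' \<or> G' \<subseteq> G"
    "exp (- (d\<^sup>2 * n / 8)) * ?X \<le> ?cnt G'" by blast
  have fG': "finite G'" using G' fE finite_subset by blast
  have tN: "2 * t * ?N \<le> 2 * \<kappa> * ?N" using t by (intro mult_right_mono) auto
  \<comment> \<open>As \<open>G\<close> and \<open>G'\<close> are nested, the change inside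
    \<open>W\<close> is at most the total change.\<close>
  have diff: "\<bar>real (card (induced G' W)) - real (card (induced G W))\<bar> \<le> 2 * \<kappa> * ?N" for W
  proof -
    have sub: "card (induced H' W) - card (induced H W) \<le> card H' - card H \<and> card (induced H W) \<le> card (induced H' W)"
      if "H \<subseteq> H'" "finite H'" for H H'
    proof -
      have fin: "finite H" "finite (induced H W)" "finite (induced H' W)" "induced H W \<subseteq> induced H' W"
        using that by (auto simp: induced_def finite_subset)
      have "card (induced H' W) - card (induced H W) = card (induced H' W - induced H W)"
        using fin by (simp add: card_Diff_subset)
      also have "\<dots> \<le> card (H' - H)" using that by (intro card_mono) (auto simp: induced_def)
      also have "\<dots> = card H' - card H" using that fin by (simp add: card_Diff_subset)
      finally show ?thesis using fin by (simp add: card_mono)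
    qed
    from G'(3) show ?thesis
    proof
      assume s: "G \<subseteq> G'"
      then show ?thesis using sub[OF s fG'] card_mono[OF fG' s] low G'(1) m by linarith
    next
      assume s: "G' \<subseteq> G"
      then show ?thesis using sub[OF s fG] card_mono[OF fG s] up tN G'(1) m by linarith
    qed
  qed
  have "quasi_random r n \<epsilon> p G'"
    unfolding quasi_random_def
  proof (intro conjI allI impI)
    show "is_rgraph r n G'" using G'(2) by (auto simp: is_rgraph_def subsets_of_card_def)
    show "real (card G') = p * real (n choose r)" using G' m by simp
    fix W assume "W \<subseteq> {0..<n} \<and> card W = n div 2"
    then have W: "W \<subseteq> {0..<n}" "card W = h" by (auto simp: h_def)
    \<comment> \<open>The change of edges and the deviation of \<open>G\<close> each cost at most
      \<open>\<epsilon> / 4\<close>, leaving room for the strict inequalities.\<close>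
    have "2 * \<kappa> * ?N \<le> 2 * \<kappa> * (B * ?Nh)" using B \<kappa> by (intro mult_left_mono) auto
    moreover have "2 * \<kappa> * (B * ?Nh) = \<epsilon> / 4 * ?Nh" unfolding \<kappa>(2)[symmetric] by simp
    moreover have "2 * \<kappa> * ?Nh \<le> \<epsilon> / 4 * ?Nh"
      using \<kappa> B mult_right_mono[of 1 B "2 * \<kappa>"] by (intro mult_right_mono) auto
    ultimately have "\<bar>real (card (induced G' W)) - p * ?Nh\<bar> \<le> \<epsilon> / 2 * ?Nh"
      using diff[of W] GW[OF W] by linarith
    moreover have "\<epsilon> / 2 * ?Nh < \<epsilon> * ?Nh" using \<epsilon> Nh by simp
    ultimately have "\<bar>real (card (induced G' W)) - p * ?Nh\<bar> < \<epsilon> * ?Nh" by linarith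
    then have "(p - \<epsilon>) * ?Nh < card (induced G' W)" "card (induced G' W) < (p + \<epsilon>) * ?Nh"
      by (auto simp: algebra_simps)
    then show "p - \<epsilon> < density r (card W) (induced G' W)" "density r (card W) (induced G' W) < p + \<epsilon>"
      using Nh by (auto simp: density_def W(2) pos_less_divide_eq pos_divide_less_eq)
  qed
  then show ?thesis using G' by blast
qed

subsection \<open>Asymptotics\<close>

lemma num_ham_le_H_max:
  assumes "quasi_random r n \<epsilon> p G"
  shows "num_ham r n G \<le> H_max r n p \<epsilon>"
  unfolding H_max_def
proof (rule Max_ge)
  have "{num_ham r n G | G. quasi_random r n \<epsilon> p G} \<subseteq> num_ham r n ` Pow (Pow {0..<n})"
    by (auto simp: quasi_random_def is_rgraph_def)
  then show "finite {num_ham r n G | G. quasi_random r n \<epsilon> p G}"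
    by (rule finite_subset) simp
qed (use assms in auto)

text \<open>Since \<open>1 + x \<ge> exp (x / 2)\<close> on the unit interval, the power is at least
  \<open>exp (d^2 / 2 * (n div 2))\<close>; the subtracted \<open>d^2 / 4\<close> pays for rounding
  \<open>n / 2\<close> down.\<close>

lemma exp_half_le_power:
  fixes d :: real
  assumes "0 \<le> d" "d \<le> 1"
  shows "exp (d\<^sup>2 * n / 4 - d\<^sup>2 / 4) \<le> (1 + d\<^sup>2) ^ (n div 2)"
proof -
  have exp_half: "exp (x / 2) \<le> 1 + x" if "0 \<le> x" "x \<le> 1" for x :: real
  proof -
    have "exp (x / 2) \<le> 1 + x / 2 + (x / 2)\<^sup>2"
      using that by (intro exp_le_quadratic) simp
    moreover have "(x / 2)\<^sup>2 \<le> x / 2"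
      using that mult_right_mono[of x 1 x] by (simp add: power2_eq_square)
    ultimately show ?thesis by simp
  qed
  have "real n \<le> 2 * real (n div 2) + 1" by linarith
  then have "d\<^sup>2 * real n \<le> d\<^sup>2 * (2 * real (n div 2) + 1)" by (intro mult_left_mono) auto
  then have "d\<^sup>2 * n / 4 - d\<^sup>2 / 4 \<le> real (n div 2) * (d\<^sup>2 / 2)" by (simp add: algebra_simps)
  then have "exp (d\<^sup>2 * n / 4 - d\<^sup>2 / 4) \<le> exp (real (n div 2) * (d\<^sup>2 / 2))"
    unfolding exp_le_cancel_iff .
  also have "\<dots> = exp (d\<^sup>2 / 2) ^ (n div 2)" by (rule exp_of_nat_mult)
  also have "\<dots> \<le> (1 + d\<^sup>2) ^ (n div 2)"
    using assms by (intro power_mono exp_half) (auto simp: power_le_one)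
  finally show ?thesis .
qed

text \<open>The gain \<open>exp (d^2 * n / 4)\<close> from correlation, less the loss
  \<open>exp (- (d^2 * n / 8))\<close> from deletion, leaves \<open>exp (d^2 * n / 8)\<close>; the
  division by \<open>n ^ r\<close> converts orderings into cycles.\<close>

lemma H_max_lower_bound:
  fixes p d t \<epsilon> B :: real and r n m :: nat
  defines "h \<equiv> n div 2" and "\<kappa> \<equiv> \<epsilon> / (8 * B)"
  assumes r: "3 \<le> r" "r \<le> h" and p: "0 < p" "p < 1" and \<epsilon>: "0 < \<epsilon>"
    and d: "0 \<le> d" "d \<le> 1" "d * real (r choose 2) \<le> 1/2" "p * (1 + d * real (r choose 2)) \<le> 1"
      "d * real (r choose 2) \<le> \<kappa>"
    and t: "0 \<le> t" "t \<le> 1" "t \<le> \<kappa>" "32 * t \<le> p * d\<^sup>2"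
    and bad: "2 * exp (- (t\<^sup>2 * real (n choose 2) / 4)) + 2 ^ (n + 1) * (2 * exp (- (t\<^sup>2 * real (h choose r) / 4))) \<le> p ^ n / 2"
    and B: "1 \<le> B" "real (n choose r) \<le> B * real (h choose r)"
    and m: "real m = p * real (n choose r)" "2 * n \<le> m"
  shows "exp (d\<^sup>2 * n / 8 - d\<^sup>2 / 4) / real n ^ r \<le> real (H_max r n p \<epsilon>) / E_exp n p"
proof -
  let ?X = "(1 + d\<^sup>2) ^ (n div 2)" and ?e = "exp (- (d\<^sup>2 * n / 8))"
  obtain G where G: "quasi_random r n \<epsilon> p G"
    and cnt: "?e * (fact n * p ^ n * (?X - 1/2)) \<le> real (card {\<sigma>. \<sigma> permutes {0..<n} \<and> cycle_edges r n \<sigma> \<subseteq> G})"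
    using exists_quasi_random[OF r[unfolded h_def] p \<epsilon> d(1,3,4) d(5)[unfolded \<kappa>_def] t(1,2) t(3)[unfolded \<kappa>_def] t(4)
        bad[unfolded h_def] B(1) B(2)[unfolded h_def] m] by blast
  have n: "0 < n" "r \<le> n" using r by (auto simp: h_def)
  have "card {\<sigma>. \<sigma> permutes {0..<n} \<and> cycle_edges r n \<sigma> \<subseteq> G} \<le> num_ham r n G * n ^ r"
    using G r n by (intro card_hamiltonian_orderings_le) (auto simp: quasi_random_def)
  also have "\<dots> \<le> H_max r n p \<epsilon> * n ^ r"
    using num_ham_le_H_max[OF G] by simp
  finally have "real (card {\<sigma>. \<sigma> permutes {0..<n} \<and> cycle_edges r n \<sigma> \<subseteq> G}) \<le> real (H_max r n p \<epsilon>) * real n ^ r"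
    unfolding of_nat_mult[symmetric] of_nat_power[symmetric] of_nat_le_iff .
  with cnt have main: "?e * (fact n * p ^ n * (?X - 1/2)) \<le> real (H_max r n p \<epsilon>) * real n ^ r" by linarith
  have "1 \<le> ?X" by (simp add: one_le_power)
  \<comment> \<open>For \<open>?X \<ge> 1\<close> one has \<open>?X - 1/2 \<ge> ?X / 2\<close>, and
    this factor 1/2 matches the one in \<open>E_exp\<close>.\<close>
  then have X: "exp (d\<^sup>2 * n / 4 - d\<^sup>2 / 4) / 2 \<le> ?X - 1/2"
    using exp_half_le_power[OF d(1,2), of n] by linarith
  have fact: "fact n = real n * fact (n - 1)" using n by (simp add: fact_reduce)
  have "exp (d\<^sup>2 * n / 8 - d\<^sup>2 / 4) * E_exp n p = (?e * exp (d\<^sup>2 * n / 4 - d\<^sup>2 / 4)) * E_exp n p"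
    by (simp add: exp_add[symmetric])
  \<comment> \<open>The spare factor \<open>n\<close> of \<open>fact n\<close> against
    \<open>fact (n - 1)\<close> is given away.\<close>
  also have "\<dots> \<le> real n * \<dots>"
  proof -
    have "z \<le> real n * z" if "0 \<le> z" for z :: real
      using n that mult_right_mono[of 1 "real n" z] by simp
    then show ?thesis using p by (simp add: E_exp_def)
  qed
  also have "\<dots> = ?e * (fact n * p ^ n * (exp (d\<^sup>2 * n / 4 - d\<^sup>2 / 4) / 2))"
    by (simp add: fact E_exp_def)
  also have "\<dots> \<le> ?e * (fact n * p ^ n * (?X - 1/2))"
    using X p by (intro mult_left_mono) auto
  also note main
  finally show ?thesis
    using n p by (simp add: field_simps E_exp_def)
qed

section \<open>Binomial estimates for large \<open>n\<close>\<close>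

lemma choose_ge_cube:
  assumes "3 \<le> r" "r \<le> k"
  shows "(real k / real r) ^ 3 \<le> real (k choose r)"
proof -
  \<comment> \<open>A fixed cubic bound serves all \<open>r \<ge> 3\<close> at once: it already
    beats the linear exponents of the union bound and the requirement
    \<open>2 * n \<le> m\<close>.\<close>
  have "(real k / real r) ^ 3 \<le> (real k / real r) ^ r"
    using assms by (intro power_increasing) (auto simp: field_simps)
  also have "\<dots> \<le> real (k choose r)"
    using binomial_ge_n_over_k_pow_k[of r k, where 'a = real] assms by simp
  finally show ?thesis .
qed

text \<open>Both binomials have order \<open>n ^ r\<close>, so their ratio is bounded independently
  of \<open>n\<close>; this supplies the constant \<open>B\<close>.\<close>

lemma choose_le_choose_half:
  assumes "0 < r" "3 * r \<le> n"
  shows "real (n choose r) \<le> (3 * real r) ^ r * real ((n div 2) choose r)"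
proof -
  have h: "real n \<le> 3 * real (n div 2)" "r \<le> n div 2" using assms by linarith+
  have "real (n choose r) \<le> real n ^ r"
    unfolding of_nat_power[symmetric] of_nat_le_iff using assms(2) by (intro binomial_le_pow) simp
  also have "\<dots> \<le> (3 * real (n div 2)) ^ r" using h by (intro power_mono) auto
  also have "\<dots> = (3 * real r) ^ r * (real (n div 2) / real r) ^ r"
    unfolding power_mult_distrib[symmetric] using assms(1) by simp
  also have "\<dots> \<le> (3 * real r) ^ r * real ((n div 2) choose r)"
    using h(2) by (intro mult_left_mono binomial_ge_n_over_k_pow_k) auto
  finally show ?thesis .
qed

text \<open>The exponents are of order at least \<open>n^2\<close> for the signs and
  \<open>n^3\<close> for the edges, while the number of test families and \<open>1 / p ^ n\<close>
  are only exponential in \<open>n\<close>.\<close>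

lemma eventually_failure_probability_small:
  fixes p t :: real
  assumes "0 < t" "0 < p" "p < 1" "3 \<le> r"
  shows "\<forall>\<^sub>F n in sequentially. 2 * exp (- (t\<^sup>2 * real (n choose 2) / 4))
    + 2 ^ (n + 1) * (2 * exp (- (t\<^sup>2 * real ((n div 2) choose r) / 4))) \<le> p ^ n / 2"
proof -
  define s a b where "s = t\<^sup>2 / 4" and "a = - ln p" and "b = 3 * real r"
  have pos: "0 < s" "0 < a" "0 < b" using assms by (auto simp: s_def a_def b_def)
  have "\<forall>\<^sub>F n :: nat in sequentially. 2 * exp (- (s * (real n ^ 2 / 4)))
      + 4 * exp (real n * ln 2) * exp (- (s * (real n / b) ^ 3)) \<le> exp (- (a * real n)) / 2"
    using pos by real_asymp
  moreover have "\<forall>\<^sub>F n in sequentially. 3 * r \<le> n" by (rule eventually_ge_at_top)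
  ultimately show ?thesis
  proof eventually_elim
    case (elim n)
    have "real n ^ 2 / 4 \<le> real (n choose 2)"
    proof -
      have "real (n choose 2) = real n * (real n - 1) / 2"
        using elim(2) assms(4) by (simp add: choose_two real_of_nat_div of_nat_diff)
      moreover have "real n * 2 \<le> real n * real n" using elim(2) assms(4) by (intro mult_left_mono) auto
      ultimately show ?thesis by (simp add: power2_eq_square algebra_simps)
    qed
    then have "s * (real n ^ 2 / 4) \<le> s * real (n choose 2)" using pos by (intro mult_left_mono) auto
    then have 1: "exp (- (t\<^sup>2 * real (n choose 2) / 4)) \<le> exp (- (s * (real n ^ 2 / 4)))" by (simp add: s_def)
    have h: "real n \<le> 3 * real (n div 2)" "r \<le> n div 2" using elim(2) assms(4) by linarith+
    have "(real n / b) ^ 3 \<le> (real (n div 2) / real r) ^ 3"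
      using h assms(4) by (intro power_mono) (auto simp: b_def field_simps)
    also have "\<dots> \<le> real ((n div 2) choose r)" using assms(4) h by (intro choose_ge_cube)
    finally have "s * (real n / b) ^ 3 \<le> s * real ((n div 2) choose r)" using pos by (intro mult_left_mono) auto
    then have 2: "exp (- (t\<^sup>2 * real ((n div 2) choose r) / 4)) \<le> exp (- (s * (real n / b) ^ 3))" by (simp add: s_def)
    have 3: "exp (real n * ln 2) = 2 ^ n" "exp (- (a * real n)) = p ^ n"
      using assms by (simp_all add: a_def exp_of_nat_mult exp_of_nat2_mult)
    have "(2::real) ^ (n + 1) * (2 * exp (- (t\<^sup>2 * real ((n div 2) choose r) / 4)))
        \<le> 2 ^ (n + 1) * (2 * exp (- (s * (real n / b) ^ 3)))"
      using 2 by (intro mult_left_mono) auto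
    also have "\<dots> = 4 * 2 ^ n * exp (- (s * (real n / b) ^ 3))" by simp
    finally show ?case using elim(1) 1 unfolding 3 by linarith
  qed
qed

theorem theorem2:
  fixes \<epsilon> p :: real and r :: nat
  assumes "\<epsilon> > 0" and "0 < p" and "p < 1" and "r \<ge> 3"
  shows "\<exists>c > 0. \<exists>g :: nat \<Rightarrow> real. g \<longlonglongrightarrow> 0 \<and>
    (\<forall>\<^sub>F n in sequentially. p * real (n choose r) \<in> \<int> \<longrightarrow>
       real (H_max r n p \<epsilon>) / E_exp n p \<ge>
         2 powr (c * real n powr ((if r = 3 then 1/3 else 1/2) - g n)))"
proof -
  define D where "D = real (r choose 2)"
  define B where "B = (3 * real r) ^ r"
  define \<kappa> where "\<kappa> = \<epsilon> / (8 * B)"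
  \<comment> \<open>In order, the bounds serve \<open>1 + x \<ge> exp (x / 2)\<close> at
    \<open>x = d^2\<close>, edge probabilities of at least \<open>p / 2\<close>, edge probabilities
    of at most 1, and edge probabilities within \<open>\<kappa>\<close> of \<open>p\<close>.\<close>
  define d where "d = Min {1, 1 / (2 * D), (1 / p - 1) / D, \<kappa> / D}"
  define t where "t = Min {1, \<kappa>, p * d\<^sup>2 / 32}"
  \<comment> \<open>Then \<open>2 powr (c * n)\<close> is \<open>exp (d^2 * n / 16)\<close>, half of
    the available exponent; the other half absorbs \<open>n ^ r\<close> and
    \<open>exp (d^2 / 4)\<close>.\<close>
  define c where "c = d\<^sup>2 / (16 * ln 2)"
  have D: "0 < D" using assms(4) by (simp add: D_def)
  have B: "1 \<le> B" unfolding B_def using assms(4) by (intro one_le_power) auto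
  have \<kappa>: "0 < \<kappa>" using B assms by (simp add: \<kappa>_def)
  have d: "0 < d" "d \<le> 1" "d \<le> 1 / (2 * D)" "d \<le> (1 / p - 1) / D" "d \<le> \<kappa> / D"
    using D \<kappa> assms by (auto simp: d_def)
  have t: "0 < t" "t \<le> 1" "t \<le> \<kappa>" "t \<le> p * d\<^sup>2 / 32"
    using d(1) \<kappa> assms by (auto simp: t_def)
  have dD: "d * D \<le> 1/2" "d * D \<le> 1 / p - 1" "d * D \<le> \<kappa>"
    using d(3-5) D by (simp_all add: pos_le_divide_eq mult_ac)
  have pD: "p * (1 + d * D) \<le> 1"
    using mult_left_mono[OF dD(2), of p] assms by (simp add: algebra_simps)
  have c: "0 < c" using d by (simp add: c_def)
  have "\<forall>\<^sub>F n :: nat in sequentially. real n ^ r \<le> exp (d\<^sup>2 / 16 * real n - d\<^sup>2 / 4)"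
    using d by real_asymp
  moreover have "\<forall>\<^sub>F n :: nat in sequentially. 2 * real n \<le> p * (real n / real r) ^ 3"
    using assms by real_asymp
  moreover have "\<forall>\<^sub>F n in sequentially. 3 * r \<le> n" by (rule eventually_ge_at_top)
  moreover note eventually_failure_probability_small[OF t(1) assms(2,3,4)]
  ultimately have "\<forall>\<^sub>F n in sequentially. p * real (n choose r) \<in> \<int> \<longrightarrow>
       real (H_max r n p \<epsilon>) / E_exp n p \<ge>
         2 powr (c * real n powr ((if r = 3 then 1/3 else 1/2) - 0))"
  proof eventually_elim
    case (elim n)
    show ?case
    proof
      assume "p * real (n choose r) \<in> \<int>"
      then have "p * real (n choose r) \<in> \<nat>" using assms by (simp add: Nats_altdef2)
      then obtain m where m: "real m = p * real (n choose r)" by (metis Nats_cases)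
      have n: "r \<le> n" "r \<le> n div 2" "1 \<le> n" using elim(3) assms(4) by linarith+
      have "2 * real n \<le> p * real (n choose r)"
        using elim(2) mult_left_mono[OF choose_ge_cube[OF assms(4) n(1)], of p] assms by linarith
      then have m2: "2 * n \<le> m" using m by linarith
      \<comment> \<open>Both exponents 1/3 and 1/2 are at most 1, the exponent for which the bound
        is proved.\<close>
      have "2 powr (c * real n powr ((if r = 3 then 1/3 else 1/2) - 0)) \<le> 2 powr (c * real n powr 1)"
        using n c by (intro powr_mono mult_left_mono) auto
      also have "\<dots> = exp (d\<^sup>2 / 16 * n)" using n by (simp add: c_def powr_def)
      also have "\<dots> \<le> exp (d\<^sup>2 * n / 8 - d\<^sup>2 / 4) / real n ^ r"
      proof -
        have "exp (d\<^sup>2 / 16 * n) * real n ^ r \<le> exp (d\<^sup>2 / 16 * n) * exp (d\<^sup>2 / 16 * n - d\<^sup>2 / 4)"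
          using elim(1) by (intro mult_left_mono) auto
        then show ?thesis using n by (simp add: exp_add[symmetric] pos_le_divide_eq mult.commute)
      qed
      also have "\<dots> \<le> real (H_max r n p \<epsilon>) / E_exp n p"
      proof (rule H_max_lower_bound[where t = t and B = B and m = m])
        show "real (n choose r) \<le> B * real (n div 2 choose r)"
          unfolding B_def using choose_le_choose_half[of r n] elim(3) assms(4) by simp
      qed (use assms n d t dD pD B elim(4) m m2 in \<open>auto simp: D_def \<kappa>_def\<close>)
      finally show "real (H_max r n p \<epsilon>) / E_exp n p \<ge>
         2 powr (c * real n powr ((if r = 3 then 1/3 else 1/2) - 0))" .
    qed
  qed
  then show ?thesis using c by (intro exI[of _ c] conjI exI[of _ "\<lambda>_. 0"]) auto
qed

end
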